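(* Let $S$ be a sporadic simple group with universal cover $\widehat{S}$, let $p$ be a prime, let $P \in \mathrm{Syl}_p(\widehat{S})$, suppose $|\Gamma_P| = 2$, and let $\alpha \in \mathrm{Aut}(\widehat{S})_P$ represent the non-trivial class $\overline{\alpha}$ of $\Gamma_P$. Let $H$ be a finite group with $\widehat{S} \trianglelefteq H$ and $[H:\widehat{S}] = 2$, such that conjugation by elements of $H \setminus \widehat{S}$ induces on $\widehat{S}$ the non-trivial outer class $\overline{\alpha}$. Then restriction of characters from $H$ to $\widehat{S}$ correctly produces the Type 1 / Type 2 partition of $\mathrm{Irr}(\widehat{S})$, with the same witness patterns as those produced by $A = \widehat{S} \rtimes \langle \alpha \rangle$. That is, for every $\theta \in \mathrm{Irr}(\widehat{S})$: (a) $\theta$ is of Type 1 if and only if there exists $\psi \in \mathrm{Irr}(H)$ with $\psi_{\widehat{S}} = \theta$, and this holds if and only if there exists $\psi' \in \mathrm{Irr}(A)$ with $\psi'_{\widehat{S}} = \theta$; (b) $\theta$ is of Type 2 if and only if there exists $\psi \in \mathrm{Irr}(H)$ with $\psi_{\widehat{S}} = \theta + \theta^\alpha$, and this holds if and only if there exists $\psi' \in \mathrm{Irr}(A)$ with $\psi'_{\widehat{S}} = \theta + \theta^\alpha$.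
   Context: A sporadic simple group is one of the 26 sporadic finite simple groups. The universal cover $\widehat{S}$ of a finite non-abelian simple group $S$ is the unique (up to isomorphism) largest finite perfect group with $\widehat{S}/Z(\widehat{S}) \cong S$ (the universal perfect central extension of $S$). $\mathrm{Aut}(\widehat{S})_P = \{\alpha \in \mathrm{Aut}(\widehat{S}) : \alpha(P) = P\}$, $\mathrm{Inn}(\widehat{S})_P = \mathrm{Inn}(\widehat{S}) \cap \mathrm{Aut}(\widehat{S})_P$, and $\Gamma_P = \mathrm{Aut}(\widehat{S})_P/\mathrm{Inn}(\widehat{S})_P$, which is naturally identified with $\mathrm{Out}(\widehat{S})$ (via the inclusion $\mathrm{Aut}(\widehat{S})_P \subseteq \mathrm{Aut}(\widehat{S})$); the hypothesis on $H$ means that for each $h \in H \setminus \widehat{S}$ the automorphism of $\widehat{S}$ given by conjugation by $h$ has image in $\mathrm{Out}(\widehat{S})$ equal to the class of $\alpha$. $\mathrm{Irr}(G)$ denotes the set of irreducible complex characters of a finite group $G$; $\psi_{\widehat{S}}$ denotes restriction to $\widehat{S}$; $\chi^\alpha(g) := \chi(\alpha^{-1}(g))$. In $A = \widehat{S} \rtimes \langle\alpha\rangle$ the cyclic group $\langle \alpha\rangle \le \mathrm{Aut}(\widehat{S})$ acts naturally on $\widehat{S}$. A character $\theta \in \mathrm{Irr}(\widehat{S})$ is of Type 1 if $\theta^\alpha = \theta$, and of Type 2 if $\theta^\alpha \neq \theta$. *)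

theory Defs
  imports
    "HOL-Algebra.Algebra"
    "HOL-Computational_Algebra.Primes"
    "Jordan_Normal_Form.VS_Connect"
begin

section \<open>Group theory\<close>

definition group_centre :: "('a, 'b) monoid_scheme \<Rightarrow> 'a set" where
  "group_centre G =
     {z \<in> carrier G. \<forall>g \<in> carrier G. z \<otimes>\<^bsub>G\<^esub> g = g \<otimes>\<^bsub>G\<^esub> z}"

definition perfect_group :: "('a, 'b) monoid_scheme \<Rightarrow> bool" where
  "perfect_group G \<longleftrightarrow> group G \<and> derived G (carrier G) = carrier G"

definition syl :: "nat \<Rightarrow> ('a, 'b) monoid_scheme \<Rightarrow> 'a set set" where
  "syl p G = {P. subgroup P G \<and> card P = p ^ multiplicity p (Coset.order G)}"

definition nonabelian_simple :: "('a, 'b) monoid_scheme \<Rightarrow> bool" where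
  "nonabelian_simple G \<longleftrightarrow> simple_group G \<and> \<not> comm_group G"


section \<open>Linear algebraic groups over an algebraically closed field\<close>

text \<open>An \<open>n \<times> n\<close> matrix over \<open>K\<close> is an extensional function on pairs of indices below \<open>n\<close>.\<close>

definition matrix_monoid :: "('a, 'b) ring_scheme \<Rightarrow> nat \<Rightarrow> (nat \<times> nat \<Rightarrow> 'a) monoid" where
  "matrix_monoid K n =
     \<lparr>carrier = ({..<n} \<times> {..<n}) \<rightarrow>\<^sub>E carrier K,
      monoid.mult = (\<lambda>A B. \<lambda>(i, j) \<in> {..<n} \<times> {..<n}.
                \<Oplus>\<^bsub>K\<^esub>k \<in> {..<n}. A (i, k) \<otimes>\<^bsub>K\<^esub> B (k, j)),
      monoid.one = (\<lambda>(i, j) \<in> {..<n} \<times> {..<n}. if i = j then \<one>\<^bsub>K\<^esub> else \<zero>\<^bsub>K\<^esub>)\<rparr>"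

definition GL :: "('a, 'b) ring_scheme \<Rightarrow> nat \<Rightarrow> (nat \<times> nat \<Rightarrow> 'a) monoid" where
  "GL K n = units_of (matrix_monoid K n)"

text \<open>
  The coordinate ring of \<open>GL\<^sub>n\<close> is generated by the matrix entries and \<open>1/det\<close>; equivalently,
  by the entries of \<open>g\<close> and of its inverse.
\<close>

inductive_set regular_functions :: "('a, 'b) ring_scheme \<Rightarrow> nat \<Rightarrow> ((nat \<times> nat \<Rightarrow> 'a) \<Rightarrow> 'a) set"
  for K :: "('a, 'b) ring_scheme" and n :: nat where
  const: "c \<in> carrier K \<Longrightarrow> (\<lambda>g. c) \<in> regular_functions K n"
| entry: "i < n \<Longrightarrow> j < n \<Longrightarrow> (\<lambda>g. g (i, j)) \<in> regular_functions K n"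
| inv_entry: "i < n \<Longrightarrow> j < n \<Longrightarrow> (\<lambda>g. (inv\<^bsub>GL K n\<^esub> g) (i, j)) \<in> regular_functions K n"
| add: "f \<in> regular_functions K n \<Longrightarrow> h \<in> regular_functions K n \<Longrightarrow>
          (\<lambda>g. f g \<oplus>\<^bsub>K\<^esub> h g) \<in> regular_functions K n"
| mult: "f \<in> regular_functions K n \<Longrightarrow> h \<in> regular_functions K n \<Longrightarrow>
          (\<lambda>g. f g \<otimes>\<^bsub>K\<^esub> h g) \<in> regular_functions K n"

definition zariski_closed ::
  "('a, 'b) ring_scheme \<Rightarrow> nat \<Rightarrow> (nat \<times> nat \<Rightarrow> 'a) set \<Rightarrow> bool" where
  "zariski_closed K n Z \<longleftrightarrow>
     (\<exists>F \<subseteq> regular_functions K n. Z = {g \<in> carrier (GL K n). \<forall>f \<in> F. f g = \<zero>\<^bsub>K\<^esub>})"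

definition zariski_connected ::
  "('a, 'b) ring_scheme \<Rightarrow> nat \<Rightarrow> (nat \<times> nat \<Rightarrow> 'a) set \<Rightarrow> bool" where
  "zariski_connected K n Z \<longleftrightarrow>
     \<not> (\<exists>A B. zariski_closed K n A \<and> zariski_closed K n B \<and> A \<noteq> {} \<and> B \<noteq> {} \<and>
              A \<inter> B = {} \<and> A \<union> B = Z)"

definition simple_algebraic_group ::
  "('a, 'b) ring_scheme \<Rightarrow> nat \<Rightarrow> (nat \<times> nat \<Rightarrow> 'a) set \<Rightarrow> bool" where
  "simple_algebraic_group K n G \<longleftrightarrow>
     subgroup G (GL K n) \<and> zariski_closed K n G \<and> zariski_connected K n G \<and>
     \<not> comm_group ((GL K n)\<lparr>carrier := G\<rparr>) \<and>
     (\<forall>N. N \<lhd> (GL K n)\<lparr>carrier := G\<rparr> \<and> zariski_closed K n N \<and> zariski_connected K n N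
          \<longrightarrow> N = {\<one>\<^bsub>GL K n\<^esub>} \<or> N = G)"

definition fixed_points :: "'a set \<Rightarrow> ('a \<Rightarrow> 'a) \<Rightarrow> 'a set" where
  "fixed_points G \<sigma> = {g \<in> G. \<sigma> g = g}"

definition steinberg_endomorphism ::
  "('a, 'b) ring_scheme \<Rightarrow> nat \<Rightarrow> (nat \<times> nat \<Rightarrow> 'a) set \<Rightarrow>
     ((nat \<times> nat \<Rightarrow> 'a) \<Rightarrow> (nat \<times> nat \<Rightarrow> 'a)) \<Rightarrow> bool" where
  "steinberg_endomorphism K n G \<sigma> \<longleftrightarrow>
     \<sigma> \<in> hom ((GL K n)\<lparr>carrier := G\<rparr>) ((GL K n)\<lparr>carrier := G\<rparr>) \<and>
     (\<forall>i < n. \<forall>j < n. \<exists>f \<in> regular_functions K n. \<forall>g \<in> G. \<sigma> g (i, j) = f g) \<and>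
     \<sigma> ` G = G \<and> finite (fixed_points G \<sigma>)"


section \<open>Sporadic simple groups\<close>

text \<open>
  A finite simple group of Lie type is a non-abelian simple group \<open>D / Z(D)\<close>, where \<open>D\<close> is the
  derived subgroup of the finite group of fixed points of a Steinberg endomorphism of a simple
  algebraic group in characteristic \<open>p\<close>. Most of these fixed point groups are already perfect in
  the simply connected case; passing to the derived subgroup takes care of the other isogeny
  types and of the exceptions \<open>B\<^sub>2(2)'\<close>, \<open>G\<^sub>2(2)'\<close>, \<open>\<^sup>2G\<^sub>2(3)'\<close> and the Tits group \<open>\<^sup>2F\<^sub>4(2)'\<close>, so the
  Tits group counts as a group of Lie type. As the algebraic closure of a finite prime field is
  countable, it suffices to consider fields whose elements are natural numbers.
\<close>

definition lie_type :: "('a, 'b) monoid_scheme \<Rightarrow> bool" where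
  "lie_type S \<longleftrightarrow> nonabelian_simple S \<and> finite (carrier S) \<and>
     (\<exists>(p :: nat) (K :: nat ring) n G \<sigma> D.
        Factorial_Ring.prime p \<and> algebraically_closed K \<and> add_pow K p \<one>\<^bsub>K\<^esub> = \<zero>\<^bsub>K\<^esub> \<and>
        simple_algebraic_group K n G \<and> steinberg_endomorphism K n G \<sigma> \<and>
        D = (GL K n)\<lparr>carrier := derived (GL K n) (fixed_points G \<sigma>)\<rparr> \<and>
        S \<cong> D Mod group_centre D)"

text \<open>
  The sporadic simple groups are the finite simple groups in none of the infinite families of
  the classification of finite simple groups (cyclic of prime order, alternating, of Lie type);
  the classification says that there are 26 of them.
\<close>

definition sporadic :: "('a, 'b) monoid_scheme \<Rightarrow> bool" where
  "sporadic S \<longleftrightarrow> nonabelian_simple S \<and> finite (carrier S) \<and>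
     (\<forall>n \<ge> 5. \<not> S \<cong> alt_group n) \<and> \<not> lie_type S"


section \<open>Universal covers\<close>

text \<open>
  ``Largest'' means that every finite perfect group \<open>E\<close> with \<open>E / Z(E) \<cong> S\<close> is a homomorphic image.
  Every finite group has a copy whose elements are natural numbers.
\<close>

definition universal_cover :: "('a, 'b) monoid_scheme \<Rightarrow> ('s, 't) monoid_scheme \<Rightarrow> bool" where
  "universal_cover U S \<longleftrightarrow>
     perfect_group U \<and> finite (carrier U) \<and> U Mod group_centre U \<cong> S \<and>
     (\<forall>E :: nat monoid. perfect_group E \<and> finite (carrier E) \<and> E Mod group_centre E \<cong> S
        \<longrightarrow> epi U E \<noteq> {})"


section \<open>Automorphisms\<close>

definition conj_by :: "('a, 'b) monoid_scheme \<Rightarrow> 'a set \<Rightarrow> 'a \<Rightarrow> 'a \<Rightarrow> 'a" where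
  "conj_by G N h = (\<lambda>x \<in> N. h \<otimes>\<^bsub>G\<^esub> x \<otimes>\<^bsub>G\<^esub> inv\<^bsub>G\<^esub> h)"

definition inner_auts :: "('a, 'b) monoid_scheme \<Rightarrow> ('a \<Rightarrow> 'a) set" where
  "inner_auts G = conj_by G (carrier G) ` carrier G"

text \<open>The image of \<open>\<phi>\<close> in \<open>Out(G) = Aut(G) / Inn(G)\<close>.\<close>

definition out_class :: "('a, 'b) monoid_scheme \<Rightarrow> ('a \<Rightarrow> 'a) \<Rightarrow> ('a \<Rightarrow> 'a) set" where
  "out_class G \<phi> = inner_auts G #>\<^bsub>AutoGroup G\<^esub> \<phi>"

definition auts_stab :: "('a, 'b) monoid_scheme \<Rightarrow> 'a set \<Rightarrow> ('a \<Rightarrow> 'a) set" where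
  "auts_stab G P = {\<phi> \<in> auto G. \<phi> ` P = P}"

definition inner_stab :: "('a, 'b) monoid_scheme \<Rightarrow> 'a set \<Rightarrow> ('a \<Rightarrow> 'a) set" where
  "inner_stab G P = inner_auts G \<inter> auts_stab G P"

definition Gamma_group :: "('a, 'b) monoid_scheme \<Rightarrow> 'a set \<Rightarrow> ('a \<Rightarrow> 'a) set monoid" where
  "Gamma_group G P = (AutoGroup G)\<lparr>carrier := auts_stab G P\<rparr> Mod inner_stab G P"

definition Gamma_class ::
  "('a, 'b) monoid_scheme \<Rightarrow> 'a set \<Rightarrow> ('a \<Rightarrow> 'a) \<Rightarrow> ('a \<Rightarrow> 'a) set" where
  "Gamma_class G P \<phi> = inner_stab G P #>\<^bsub>AutoGroup G\<^esub> \<phi>"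

text \<open>
  \<open>G \<rtimes> \<langle>\<alpha>\<rangle>\<close> for \<open>\<alpha> \<in> Aut(G)\<close>. The order of \<open>\<alpha>\<close> itself may exceed the order of its outer class.
\<close>

definition semidirect_cyclic ::
  "('a, 'b) monoid_scheme \<Rightarrow> ('a \<Rightarrow> 'a) \<Rightarrow> ('a \<times> ('a \<Rightarrow> 'a)) monoid" where
  "semidirect_cyclic G \<alpha> =
     \<lparr>carrier = carrier G \<times> generate (AutoGroup G) {\<alpha>},
      monoid.mult = (\<lambda>(s, \<phi>) (t, \<psi>). (s \<otimes>\<^bsub>G\<^esub> \<phi> t, \<phi> \<otimes>\<^bsub>AutoGroup G\<^esub> \<psi>)),
      monoid.one = (\<one>\<^bsub>G\<^esub>, \<one>\<^bsub>AutoGroup G\<^esub>)\<rparr>"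


section \<open>Complex characters\<close>

definition mat_trace :: "complex mat \<Rightarrow> complex" where
  "mat_trace A = (\<Sum>i < dim_row A. A $$ (i, i))"

definition representation ::
  "('a, 'b) monoid_scheme \<Rightarrow> nat \<Rightarrow> ('a \<Rightarrow> complex mat) \<Rightarrow> bool" where
  "representation G n \<rho> \<longleftrightarrow> \<rho> \<in> hom G (units_of (ring_mat TYPE(complex) n ()))"

definition irreducible_representation ::
  "('a, 'b) monoid_scheme \<Rightarrow> nat \<Rightarrow> ('a \<Rightarrow> complex mat) \<Rightarrow> bool" where
  "irreducible_representation G n \<rho> \<longleftrightarrow> representation G n \<rho> \<and> n > 0 \<and>
     (\<forall>W. VectorSpace.subspace class_ring W (module_vec TYPE(complex) n) \<and>
          (\<forall>g \<in> carrier G. \<forall>w \<in> W. \<rho> g *\<^sub>v w \<in> W)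
          \<longrightarrow> W = {0\<^sub>v n} \<or> W = carrier_vec n)"

text \<open>
  Characters are extensional functions on the group, so that an equation between class functions
  on \<open>G\<close> says that they agree on \<open>carrier G\<close>.
\<close>

definition Irr :: "('a, 'b) monoid_scheme \<Rightarrow> ('a \<Rightarrow> complex) set" where
  "Irr G = {\<chi>. \<exists>n \<rho>. irreducible_representation G n \<rho> \<and>
                     \<chi> = (\<lambda>g \<in> carrier G. mat_trace (\<rho> g))}"

definition twist ::
  "('a, 'b) monoid_scheme \<Rightarrow> ('a \<Rightarrow> complex) \<Rightarrow> ('a \<Rightarrow> 'a) \<Rightarrow> ('a \<Rightarrow> complex)" where
  "twist G \<chi> \<alpha> = (\<lambda>g \<in> carrier G. \<chi> (inv_into (carrier G) \<alpha> g))"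

definition char_add ::
  "('a, 'b) monoid_scheme \<Rightarrow> ('a \<Rightarrow> complex) \<Rightarrow> ('a \<Rightarrow> complex) \<Rightarrow> ('a \<Rightarrow> complex)" where
  "char_add G \<chi> \<eta> = (\<lambda>g \<in> carrier G. \<chi> g + \<eta> g)"

definition res :: "('a, 'b) monoid_scheme \<Rightarrow> ('a \<Rightarrow> complex) \<Rightarrow> ('a \<Rightarrow> complex)" where
  "res N \<psi> = (\<lambda>s \<in> carrier N. \<psi> s)"

text \<open>Restriction from \<open>G \<rtimes> \<langle>\<alpha>\<rangle>\<close> to \<open>G\<close>, embedded by \<open>s \<mapsto> (s, 1)\<close>.\<close>

definition res_semidirect ::
  "('a, 'b) monoid_scheme \<Rightarrow> ('a \<times> ('a \<Rightarrow> 'a) \<Rightarrow> complex) \<Rightarrow> ('a \<Rightarrow> complex)" where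
  "res_semidirect G \<psi> = (\<lambda>s \<in> carrier G. \<psi> (s, \<one>\<^bsub>AutoGroup G\<^esub>))"

definition type_1 :: "('a, 'b) monoid_scheme \<Rightarrow> ('a \<Rightarrow> 'a) \<Rightarrow> ('a \<Rightarrow> complex) \<Rightarrow> bool" where
  "type_1 G \<alpha> \<theta> \<longleftrightarrow> twist G \<theta> \<alpha> = \<theta>"

definition type_2 :: "('a, 'b) monoid_scheme \<Rightarrow> ('a \<Rightarrow> 'a) \<Rightarrow> ('a \<Rightarrow> complex) \<Rightarrow> bool" where
  "type_2 G \<alpha> \<theta> \<longleftrightarrow> twist G \<theta> \<alpha> \<noteq> \<theta>"

end

theory Submission
  imports Defs "Jordan_Normal_Form.Spectral_Radius"
begin

text \<open>
  Write \<open>N\<close> for the cover. Correcting an element of \<open>H - N\<close> by an element of \<open>N\<close> gives \<open>g \<in> H\<close> that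
  induces \<open>\<alpha>\<close> itself on \<open>N\<close>; hence \<open>\<alpha>\<^sup>2\<close> is conjugation by \<open>t = g\<^sup>2 \<in> N\<close>. So \<open>H\<close> and \<open>N \<rtimes> \<langle>\<alpha>\<rangle>\<close> are both
  extensions of \<open>N\<close> by a cyclic group, with a generator that acts as \<open>\<alpha>\<close>, and it suffices to treat
  such an extension \<open>G = N\<langle>g\<rangle>\<close> with \<open>g\<^sup>m = u \<in> N\<close> and \<open>m\<close> minimal. Let \<open>\<rho>\<close> afford \<open>\<theta>\<close>.

  If \<open>\<theta>\<close> is \<open>\<alpha>\<close>-invariant, then \<open>\<rho> \<circ> \<alpha>\<close> is equivalent to \<open>\<rho>\<close>. By Schur's lemma the intertwiner \<open>M\<close> can
  be scaled so that \<open>M\<^sup>m = \<rho>(u)\<close>, and \<open>g \<mapsto> M\<close> extends \<open>\<rho>\<close> to \<open>G\<close>. Conversely, the restriction of a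
  class function on \<open>G\<close> is \<open>\<alpha>\<close>-invariant.

  If \<open>\<theta>\<close> is not invariant, then \<open>m\<close> is even and a multiple \<open>Y\<close> of \<open>\<rho>(t)\<close>, scaled so that \<open>Y\<close> to the
  power \<open>m/2\<close> is \<open>\<rho>(u)\<close>, makes \<open>\<rho> \<oplus> \<rho> \<circ> \<alpha>\<^sup>-\<^sup>1\<close> a \<open>G\<close>-module on which \<open>g\<close> acts by \<open>(v, w) \<mapsto> (Y w, v)\<close>; it
  is irreducible since the two inequivalent summands are swapped. Conversely, if \<open>\<theta>\<close> is invariant,
  then no irreducible character of \<open>G\<close> restricts to \<open>2\<theta>\<close>.
\<close>

section \<open>Complex representations\<close>

lemma vec_subspace_iff:
  "VectorSpace.subspace class_ring W (module_vec TYPE(complex) n) \<longleftrightarrow>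
     W \<subseteq> carrier_vec n \<and> 0\<^sub>v n \<in> W \<and> (\<forall>v\<in>W. \<forall>w\<in>W. v + w \<in> W) \<and> (\<forall>c. \<forall>v\<in>W. c \<cdot>\<^sub>v v \<in> W)"
proof -
  interpret vec_space "TYPE(complex)" n .
  have "Module.module class_ring (module_vec TYPE(complex) n)" "vectorspace class_ring (module_vec TYPE(complex) n)"
    by unfold_locales
  then show ?thesis
    unfolding subspace_def submodule_def by (auto simp: module_vec_def)
qed

text \<open>Invertibility comes for free in a group: \<rho>(1) is idempotent with a left inverse, so
  it is the identity, and conversely the image of the inverse of \<open>g\<close> inverts \<rho>(g).
  All representations below are built through this form.\<close>

lemma representation_iff:
  assumes "group G"
  shows "representation G n \<rho> \<longleftrightarrow>
    (\<forall>g\<in>carrier G. \<rho> g \<in> carrier_mat n n) \<and>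
    (\<forall>g\<in>carrier G. \<forall>h\<in>carrier G. \<rho> (g \<otimes>\<^bsub>G\<^esub> h) = \<rho> g * \<rho> h) \<and> \<rho> \<one>\<^bsub>G\<^esub> = 1\<^sub>m n"
    (is "?L = ?R")
proof
  interpret group G by fact
  assume ?L
  then have c: "\<And>g. g \<in> carrier G \<Longrightarrow> \<rho> g \<in> carrier_mat n n"
    and u: "\<And>g. g \<in> carrier G \<Longrightarrow> \<exists>y\<in>carrier_mat n n. y * \<rho> g = 1\<^sub>m n"
    and m: "\<And>g h. g \<in> carrier G \<Longrightarrow> h \<in> carrier G \<Longrightarrow> \<rho> (g \<otimes>\<^bsub>G\<^esub> h) = \<rho> g * \<rho> h"
    unfolding representation_def hom_def units_of_def Units_def ring_mat_def by auto
  from u[OF one_closed] obtain y where y: "y \<in> carrier_mat n n" "y * \<rho> \<one>\<^bsub>G\<^esub> = 1\<^sub>m n" by auto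
  have "\<rho> \<one>\<^bsub>G\<^esub> = y * \<rho> \<one>\<^bsub>G\<^esub> * \<rho> \<one>\<^bsub>G\<^esub>" using c[OF one_closed] y by simp
  also have "\<dots> = y * \<rho> \<one>\<^bsub>G\<^esub>" using m[OF one_closed one_closed] c[OF one_closed] y(1)
    by (simp add: assoc_mult_mat[of y n n _ n _ n])
  finally show ?R using c m y by auto
next
  interpret group G by fact
  assume R: ?R
  have "\<exists>y\<in>carrier_mat n n. y * \<rho> g = 1\<^sub>m n \<and> \<rho> g * y = 1\<^sub>m n" if "g \<in> carrier G" for g
    using R that by (intro bexI[of _ "\<rho> (inv\<^bsub>G\<^esub> g)"]) (metis inv_closed l_inv r_inv, auto)
  with R show ?L unfolding representation_def hom_def units_of_def Units_def ring_mat_def by auto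
qed

lemma mat_eq_by_vecI:
  fixes A B :: "complex mat"
  assumes A: "A \<in> carrier_mat m n" and B: "B \<in> carrier_mat m n"
    and eq: "\<And>v. v \<in> carrier_vec n \<Longrightarrow> A *\<^sub>v v = B *\<^sub>v v"
  shows "A = B"
proof (rule eq_matI)
  fix i j assume "i < dim_row B" "j < dim_col B"
  then have ij: "i < m" "j < n" using B by auto
  have "(A *\<^sub>v unit_vec n j) $ i = A $$ (i, j)" "(B *\<^sub>v unit_vec n j) $ i = B $$ (i, j)"
    using ij A B by auto
  then show "A $$ (i, j) = B $$ (i, j)" using eq[of "unit_vec n j"] by simp
qed (use A B in auto)

lemma smult_mat_mult_vec:
  fixes A :: "complex mat"
  assumes "A \<in> carrier_mat m n" "v \<in> carrier_vec n"
  shows "(c \<cdot>\<^sub>m A) *\<^sub>v v = c \<cdot>\<^sub>v (A *\<^sub>v v)"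
  using assms by (intro eq_vecI) (auto simp: scalar_prod_def sum_distrib_left mult.assoc)

lemma zero_mat_mult_vec:
  fixes v :: "complex vec"
  assumes "v \<in> carrier_vec n"
  shows "0\<^sub>m m n *\<^sub>v v = 0\<^sub>v m"
  using assms by (intro eq_vecI) (auto simp: scalar_prod_def)

section \<open>Schur's lemma and intertwiners\<close>

lemma irreducible_invariant_subspace:
  assumes "irreducible_representation G n \<rho>"
    and "W \<subseteq> carrier_vec n" "0\<^sub>v n \<in> W"
    and "\<And>v w. v \<in> W \<Longrightarrow> w \<in> W \<Longrightarrow> v + w \<in> W" "\<And>c v. v \<in> W \<Longrightarrow> c \<cdot>\<^sub>v v \<in> W"
    and "\<And>g w. g \<in> carrier G \<Longrightarrow> w \<in> W \<Longrightarrow> \<rho> g *\<^sub>v w \<in> W"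
  shows "W = {0\<^sub>v n} \<or> W = carrier_vec n"
proof -
  have "VectorSpace.subspace class_ring W (module_vec TYPE(complex) n)"
    unfolding vec_subspace_iff using assms(2-5) by (intro conjI ballI allI) auto
  moreover have "\<forall>g\<in>carrier G. \<forall>w\<in>W. \<rho> g *\<^sub>v w \<in> W" using assms(6) by simp
  ultimately show ?thesis using assms(1) unfolding irreducible_representation_def by simp
qed

text \<open>Over the complex numbers \<open>Z\<close> has an eigenvalue; its eigenspace is nonzero
  and invariant under \<rho>, hence the whole space.\<close>

lemma schur_scalar:
  assumes G: "group G" and irr: "irreducible_representation G n \<rho>"
    and Z: "Z \<in> carrier_mat n n"
    and comm: "\<And>g. g \<in> carrier G \<Longrightarrow> Z * \<rho> g = \<rho> g * Z"
  obtains c where "Z = c \<cdot>\<^sub>m 1\<^sub>m n"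
proof -
  have n: "n > 0" and rep: "representation G n \<rho>"
    using irr unfolding irreducible_representation_def by auto
  from spectrum_non_empty[OF Z n] obtain k v where v: "v \<in> carrier_vec n" "v \<noteq> 0\<^sub>v n" "Z *\<^sub>v v = k \<cdot>\<^sub>v v"
    using Z unfolding spectrum_def eigenvalue_def eigenvector_def by auto
  let ?W = "{w \<in> carrier_vec n. Z *\<^sub>v w = k \<cdot>\<^sub>v w}"
  have "?W = {0\<^sub>v n} \<or> ?W = carrier_vec n"
  proof (rule irreducible_invariant_subspace[OF irr])
    fix g w assume g: "g \<in> carrier G" and w: "w \<in> ?W"
    have c: "\<rho> g \<in> carrier_mat n n" using rep g unfolding representation_iff[OF G] by auto
    have "Z *\<^sub>v (\<rho> g *\<^sub>v w) = (Z * \<rho> g) *\<^sub>v w" using Z c w by simp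
    also have "\<dots> = \<rho> g *\<^sub>v (Z *\<^sub>v w)" using Z c w comm[OF g] by simp
    also have "\<dots> = k \<cdot>\<^sub>v (\<rho> g *\<^sub>v w)" using c w by (simp add: mult_mat_vec)
    finally show "\<rho> g *\<^sub>v w \<in> ?W" using c w by simp
  qed (use Z in \<open>auto simp: mult_add_distrib_mat_vec mult_mat_vec smult_add_distrib_vec smult_smult_assoc mult.commute\<close>)
  with v have W: "?W = carrier_vec n" by auto
  have "Z = k \<cdot>\<^sub>m 1\<^sub>m n"
    by (rule mat_eq_by_vecI[OF Z]) (use W in \<open>auto simp: smult_mat_mult_vec[of _ n n]\<close>)
  then show ?thesis by (rule that)
qed

text \<open>The column space of \<open>f\<close> is invariant and nonzero, so it is everything, and
  preimages of the unit vectors are the columns of \<open>h\<close>. Only invariance of the column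
  space is required, without naming a second representation, so that the lemma also covers matrices
  that intertwine up to a scalar.\<close>

lemma intertwiner_right_inverse:
  assumes G: "group G" and irr: "irreducible_representation G a R"
    and f: "f \<in> carrier_mat a b" "f \<noteq> 0\<^sub>m a b"
    and \<rho>: "\<And>g. g \<in> carrier G \<Longrightarrow> \<exists>K \<in> carrier_mat b b. R g * f = f * K"
  obtains h where "h \<in> carrier_mat b a" "f * h = 1\<^sub>m a"
proof -
  have rep: "representation G a R"
    using irr unfolding irreducible_representation_def by auto
  let ?W = "{f *\<^sub>v w | w. w \<in> carrier_vec b}"
  have "?W = {0\<^sub>v a} \<or> ?W = carrier_vec a"
  proof (rule irreducible_invariant_subspace[OF irr])
    fix g v assume g: "g \<in> carrier G" and "v \<in> ?W"
    then obtain w where w: "v = f *\<^sub>v w" "w \<in> carrier_vec b" by auto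
    have c: "R g \<in> carrier_mat a a" using rep g unfolding representation_iff[OF G] by auto
    obtain K where K: "K \<in> carrier_mat b b" "R g * f = f * K" using \<rho>[OF g] by auto
    have "R g *\<^sub>v v = (R g * f) *\<^sub>v w" using c f w by simp
    also have "\<dots> = f *\<^sub>v (K *\<^sub>v w)" using K f w by simp
    finally show "R g *\<^sub>v v \<in> ?W" using K w(2) by auto
  next
    show "0\<^sub>v a \<in> ?W" using f(1) by (auto intro!: exI[of _ "0\<^sub>v b"])
  next
    fix v w assume "v \<in> ?W" "w \<in> ?W"
    then obtain v' w' where "v = f *\<^sub>v v'" "w = f *\<^sub>v w'" "v' \<in> carrier_vec b" "w' \<in> carrier_vec b" by auto
    then show "v + w \<in> ?W" using f(1)
      by (auto intro!: exI[of _ "v' + w'"] simp: mult_add_distrib_mat_vec)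
  next
    fix c v assume "v \<in> ?W"
    then obtain v' where "v = f *\<^sub>v v'" "v' \<in> carrier_vec b" by auto
    then show "c \<cdot>\<^sub>v v \<in> ?W" using f(1)
      by (auto intro!: exI[of _ "c \<cdot>\<^sub>v v'"] simp: mult_mat_vec)
  qed (use f in auto)
  moreover have "?W \<noteq> {0\<^sub>v a}"
  proof
    assume "?W = {0\<^sub>v a}"
    then have "f = 0\<^sub>m a b" by (intro mat_eq_by_vecI[OF f(1)]) (auto simp: zero_mat_mult_vec)
    with f show False by simp
  qed
  ultimately have W: "?W = carrier_vec a" by auto
  have "\<exists>w. w \<in> carrier_vec b \<and> f *\<^sub>v w = unit_vec a j" for j
  proof -
    have "unit_vec a j \<in> ?W" unfolding W by simp
    then show ?thesis by auto
  qed
  then obtain w where w: "\<And>j. w j \<in> carrier_vec b" "\<And>j. f *\<^sub>v w j = unit_vec a j" by metis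
  let ?h = "mat b a (\<lambda>(i,j). w j $ i)"
  have "f * ?h = 1\<^sub>m a"
  proof (rule mat_col_eqI)
    fix j assume "j < dim_col (1\<^sub>m a :: complex mat)"
    then have j: "j < a" by simp
    have "col ?h j = w j" using j w(1)[of j] by (intro eq_vecI) auto
    then show "col (f * ?h) j = col (1\<^sub>m a) j" using j w(2) f by (simp add: col_mult2[of f a b ?h a j])
  qed (use f in auto)
  then show ?thesis by (intro that[of ?h]) auto
qed

text \<open>If \<open>b < a\<close>, padding both factors by zeros to size \<open>a\<close> gives
  square matrices whose product is 1. They then also multiply to 1 in the other order, but there the
  diagonal entry at \<open>b\<close> is 0.\<close>

lemma right_invertible_dim_le:
  fixes f h :: "complex mat"
  assumes f: "f \<in> carrier_mat a b" and h: "h \<in> carrier_mat b a" and fh: "f * h = 1\<^sub>m a"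
  shows "a \<le> b"
proof (rule ccontr)
  assume "\<not> a \<le> b"
  then have ab: "b < a" by simp
  let ?F = "mat a a (\<lambda>(i,j). if j < b then f $$ (i,j) else 0)"
  let ?H = "mat a a (\<lambda>(i,j). if i < b then h $$ (i,j) else 0)"
  have "?F * ?H = 1\<^sub>m a"
  proof (rule eq_matI)
    fix i j assume ij: "i < dim_row (1\<^sub>m a :: complex mat)" "j < dim_col (1\<^sub>m a :: complex mat)"
    have "(?F * ?H) $$ (i,j) = (\<Sum>k<a. (if k < b then f $$ (i,k) else 0) * (if k < b then h $$ (k,j) else 0))"
      using ij by (auto simp: scalar_prod_def lessThan_atLeast0)
    also have "\<dots> = (\<Sum>k<b. f $$ (i,k) * h $$ (k,j))"
      using ab by (intro sum.mono_neutral_cong_right) auto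
    also have "\<dots> = (f * h) $$ (i,j)"
      using ij f h by (auto simp: scalar_prod_def lessThan_atLeast0)
    finally show "(?F * ?H) $$ (i,j) = 1\<^sub>m a $$ (i,j)" using fh by simp
  qed auto
  then have "?H * ?F = 1\<^sub>m a" by (rule mat_mult_left_right_inverse[rotated 2]) simp_all
  moreover have "(?H * ?F) $$ (b, b) = 0"
  proof -
    have "(?H * ?F) $$ (b, b) = (\<Sum>k<a. 0)"
      using ab by (simp add: scalar_prod_def)
    then show ?thesis by simp
  qed
  ultimately show False using ab by simp
qed

lemma mat_mult_entry:
  fixes A B :: "complex mat"
  assumes "A \<in> carrier_mat l m" "B \<in> carrier_mat m n" "i < l" "j < n"
  shows "(A * B) $$ (i,j) = (\<Sum>k<m. A $$ (i,k) * B $$ (k,j))"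
  using assms by (auto simp: scalar_prod_def lessThan_atLeast0)

lemma mat_trace_carrier: "A \<in> carrier_mat n m \<Longrightarrow> mat_trace A = (\<Sum>i<n. A $$ (i,i))"
  by (auto simp: mat_trace_def)

lemma mat_trace_mult_comm:
  assumes "A \<in> carrier_mat a b" "B \<in> carrier_mat b a"
  shows "mat_trace (A * B) = mat_trace (B * A)"
proof -
  have "mat_trace (A * B) = (\<Sum>i<a. \<Sum>k<b. A $$ (i,k) * B $$ (k,i))"
    using assms by (auto simp: mat_trace_def scalar_prod_def lessThan_atLeast0 intro!: sum.cong)
  also have "\<dots> = (\<Sum>k<b. \<Sum>i<a. B $$ (k,i) * A $$ (i,k))"
    by (subst sum.swap) (simp add: mult.commute)
  also have "\<dots> = mat_trace (B * A)"
    using assms by (auto simp: mat_trace_def scalar_prod_def lessThan_atLeast0 intro!: sum.cong)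
  finally show ?thesis .
qed

lemma mat_trace_conjugate:
  assumes "f \<in> carrier_mat n n" "h \<in> carrier_mat n n" "h * f = 1\<^sub>m n" "f * h = 1\<^sub>m n"
    and A: "A \<in> carrier_mat n n" and B: "B \<in> carrier_mat n n" and eq: "B * f = f * A"
  shows "mat_trace B = mat_trace A"
proof -
  have "B = B * f * h" using assms(1-6) by (simp add: assoc_mult_mat[of B n n f n h n])
  also have "\<dots> = f * A * h" by (simp only: eq)
  also have "\<dots> = f * (A * h)" using assms by (simp add: assoc_mult_mat[of f n n A n h n])
  also have "mat_trace \<dots> = mat_trace (A * h * f)" using assms by (subst mat_trace_mult_comm[of _ n n]) auto
  also have "A * h * f = A" using assms by (simp add: assoc_mult_mat[of A n n h n f n])
  finally show ?thesis .
qed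

lemma mat_trace_one: "mat_trace (1\<^sub>m n) = of_nat n"
  by (simp add: mat_trace_def)

section \<open>Averaging over the group and the norm of an irreducible character\<close>

context
  fixes G :: "('a, 'b) monoid_scheme"
  assumes G: "group G"
begin

interpretation group G by (rule G)

lemma rep_carrier: "representation G n \<rho> \<Longrightarrow> g \<in> carrier G \<Longrightarrow> \<rho> g \<in> carrier_mat n n"
  unfolding representation_iff[OF G] by blast

lemma rep_mult:
  "representation G n \<rho> \<Longrightarrow> g \<in> carrier G \<Longrightarrow> h \<in> carrier G \<Longrightarrow> \<rho> (g \<otimes>\<^bsub>G\<^esub> h) = \<rho> g * \<rho> h"
  unfolding representation_iff[OF G] by blast

lemma rep_one: "representation G n \<rho> \<Longrightarrow> \<rho> \<one>\<^bsub>G\<^esub> = 1\<^sub>m n"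
  unfolding representation_iff[OF G] by blast

lemma rep_pow:
  assumes "representation G n \<rho>" "g \<in> carrier G"
  shows "\<rho> (g [^]\<^bsub>G\<^esub> (k::nat)) = \<rho> g ^\<^sub>m k"
  using assms by (induction k) (auto simp: rep_one rep_mult dest: rep_carrier)

lemma rep_inv:
  assumes "representation G n \<rho>" "g \<in> carrier G"
  shows "\<rho> g * \<rho> (inv\<^bsub>G\<^esub> g) = 1\<^sub>m n" "\<rho> (inv\<^bsub>G\<^esub> g) * \<rho> g = 1\<^sub>m n"
  using assms by (simp_all flip: rep_mult rep_one)

lemma rep_trace_conjugate:
  assumes "representation G n \<rho>" "g \<in> carrier G" "h \<in> carrier G"
  shows "mat_trace (\<rho> (g \<otimes>\<^bsub>G\<^esub> h \<otimes>\<^bsub>G\<^esub> inv\<^bsub>G\<^esub> g)) = mat_trace (\<rho> h)"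
proof -
  have "g \<otimes>\<^bsub>G\<^esub> h \<otimes>\<^bsub>G\<^esub> inv\<^bsub>G\<^esub> g \<otimes>\<^bsub>G\<^esub> g = g \<otimes>\<^bsub>G\<^esub> h" using assms by (simp add: m_assoc)
  with assms show ?thesis
    by (intro mat_trace_conjugate[of "\<rho> g" n "\<rho> (inv\<^bsub>G\<^esub> g)"])
      (auto simp: rep_inv intro: rep_carrier simp flip: rep_mult)
qed

text \<open>The sum over the group of \<open>R(s) E \<rho>(s)\<^sup>-\<^sup>1\<close> for the matrix unit \<open>E\<close> at \<open>(p, q)\<close>.\<close>

definition averaged :: "nat \<Rightarrow> nat \<Rightarrow> ('a \<Rightarrow> complex mat) \<Rightarrow> ('a \<Rightarrow> complex mat) \<Rightarrow> nat \<Rightarrow> nat \<Rightarrow> complex mat" where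
  "averaged a b R \<rho> p q = mat a b (\<lambda>(i,j). \<Sum>s\<in>carrier G. R s $$ (i,p) * \<rho> (inv\<^bsub>G\<^esub> s) $$ (q,j))"

lemma averaged_carrier [simp]: "averaged a b R \<rho> p q \<in> carrier_mat a b"
  by (simp add: averaged_def)

lemma averaged_intertwines:
  assumes R: "representation G a R" and \<rho>: "representation G b \<rho>"
    and p: "p < a" and q: "q < b" and t: "t \<in> carrier G"
  shows "R t * averaged a b R \<rho> p q = averaged a b R \<rho> p q * \<rho> t"
proof (rule eq_matI)
  fix i j assume "i < dim_row (averaged a b R \<rho> p q * \<rho> t)" "j < dim_col (averaged a b R \<rho> p q * \<rho> t)"
  with rep_carrier[OF \<rho> t] have i: "i < a" and j: "j < b" by (auto simp: averaged_def)
  have "(R t * averaged a b R \<rho> p q) $$ (i,j)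
      = (\<Sum>k<a. R t $$ (i,k) * (\<Sum>s\<in>carrier G. R s $$ (k,p) * \<rho> (inv\<^bsub>G\<^esub> s) $$ (q,j)))"
    using i j rep_carrier[OF R t] by (subst mat_mult_entry[of _ a a _ b]) (auto simp: averaged_def)
  also have "\<dots> = (\<Sum>s\<in>carrier G. (\<Sum>k<a. R t $$ (i,k) * R s $$ (k,p)) * \<rho> (inv\<^bsub>G\<^esub> s) $$ (q,j))"
    by (simp add: sum_distrib_left sum_distrib_right mult.assoc sum.swap[of _ _ "{..<a}"])
  also have "\<dots> = (\<Sum>s\<in>carrier G. R (t \<otimes>\<^bsub>G\<^esub> s) $$ (i,p) * \<rho> (inv\<^bsub>G\<^esub> s) $$ (q,j))"
    using i p t by (intro sum.cong refl) (simp add: mat_mult_entry[of _ a a _ a] rep_carrier[OF R] rep_mult[OF R])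
  \<comment> \<open>Replacing \<open>s\<close> by \<open>t\<close>\<inverse>\<open>s\<close> moves
    \<open>t\<close> from the left factor to the right one.\<close>
  also have "\<dots> = (\<Sum>s\<in>carrier G. R s $$ (i,p) * \<rho> (inv\<^bsub>G\<^esub> s \<otimes>\<^bsub>G\<^esub> t) $$ (q,j))"
    using t by (intro sum.reindex_bij_witness[of _ "\<lambda>s. inv\<^bsub>G\<^esub> t \<otimes>\<^bsub>G\<^esub> s" "\<lambda>s. t \<otimes>\<^bsub>G\<^esub> s"])
      (auto simp: m_assoc[symmetric] inv_mult_group, simp add: m_assoc)
  also have "\<dots> = (\<Sum>s\<in>carrier G. R s $$ (i,p) * (\<Sum>k<b. \<rho> (inv\<^bsub>G\<^esub> s) $$ (q,k) * \<rho> t $$ (k,j)))"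
    using j q t by (intro sum.cong refl) (simp add: mat_mult_entry[of _ b b _ b] rep_carrier[OF \<rho>] rep_mult[OF \<rho>])
  also have "\<dots> = (\<Sum>k<b. (\<Sum>s\<in>carrier G. R s $$ (i,p) * \<rho> (inv\<^bsub>G\<^esub> s) $$ (q,k)) * \<rho> t $$ (k,j))"
    by (simp add: sum_distrib_left sum_distrib_right mult.assoc sum.swap[of _ _ "{..<b}"])
  also have "\<dots> = (averaged a b R \<rho> p q * \<rho> t) $$ (i,j)"
    using i j rep_carrier[OF \<rho> t] by (subst mat_mult_entry[of _ a b _ b]) (auto simp: averaged_def)
  finally show "(R t * averaged a b R \<rho> p q) $$ (i,j) = (averaged a b R \<rho> p q * \<rho> t) $$ (i,j)" .
qed (use rep_carrier[OF R t] rep_carrier[OF \<rho> t] in \<open>auto simp: averaged_def\<close>)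

text \<open>The entry at \<open>(p, q)\<close> of the average of the matrix unit at the same place
  is a product of diagonal entries summed over the group; summing over all places yields the
  unnormalised inner product of the two characters.\<close>

lemma sum_averaged_entries:
  assumes R: "representation G a R" and \<rho>: "representation G b \<rho>"
  shows "(\<Sum>p<a. \<Sum>q<b. averaged a b R \<rho> p q $$ (p,q))
    = (\<Sum>s\<in>carrier G. mat_trace (R s) * mat_trace (\<rho> (inv\<^bsub>G\<^esub> s)))"
proof -
  have "(\<Sum>p<a. \<Sum>q<b. averaged a b R \<rho> p q $$ (p,q))
    = (\<Sum>p<a. \<Sum>q<b. \<Sum>s\<in>carrier G. R s $$ (p,p) * \<rho> (inv\<^bsub>G\<^esub> s) $$ (q,q))"
    by (simp add: averaged_def)
  also have "\<dots> = (\<Sum>s\<in>carrier G. (\<Sum>p<a. R s $$ (p,p)) * (\<Sum>q<b. \<rho> (inv\<^bsub>G\<^esub> s) $$ (q,q)))"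
    by (simp add: sum_product sum.swap[of _ "carrier G"])
  also have "\<dots> = (\<Sum>s\<in>carrier G. mat_trace (R s) * mat_trace (\<rho> (inv\<^bsub>G\<^esub> s)))"
    using rep_carrier[OF R] rep_carrier[OF \<rho>]
    by (intro sum.cong refl) (simp add: mat_trace_carrier[of _ a a] mat_trace_carrier[of _ b b])
  finally show ?thesis .
qed

text \<open>First orthogonality relation of a character with itself. By Schur each average is
  scalar; the off-diagonal matrix units contribute 0 and each of the \<open>n\<close> diagonal ones
  contributes |G|/n.\<close>

lemma character_norm:
  assumes fin: "finite (carrier G)" and irr: "irreducible_representation G n \<rho>"
  shows "(\<Sum>s\<in>carrier G. mat_trace (\<rho> s) * mat_trace (\<rho> (inv\<^bsub>G\<^esub> s))) = of_nat (card (carrier G))"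
proof -
  have n: "n > 0" and rep: "representation G n \<rho>"
    using irr unfolding irreducible_representation_def by auto
  have diag: "averaged n n \<rho> \<rho> p q $$ (p,q) = (if p = q then of_nat (card (carrier G)) / of_nat n else 0)"
    if p: "p < n" and q: "q < n" for p q
  proof -
    obtain c where c: "averaged n n \<rho> \<rho> p q = c \<cdot>\<^sub>m 1\<^sub>m n"
      using averaged_intertwines[OF rep rep p q]
      by (auto intro: schur_scalar[OF G irr, of "averaged n n \<rho> \<rho> p q"])
    \<comment> \<open>The scalar is read off from the trace, which conjugation preserves: the
      average of a matrix unit has trace |G| if \<open>p = q\<close> and 0 otherwise.\<close>
    have "of_nat n * c = mat_trace (averaged n n \<rho> \<rho> p q)"
      by (simp add: c mat_trace_def)
    also have "\<dots> = (\<Sum>i<n. \<Sum>s\<in>carrier G. \<rho> s $$ (i,p) * \<rho> (inv\<^bsub>G\<^esub> s) $$ (q,i))"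
      by (simp add: averaged_def mat_trace_def)
    also have "\<dots> = (\<Sum>s\<in>carrier G. \<Sum>i<n. \<rho> (inv\<^bsub>G\<^esub> s) $$ (q,i) * \<rho> s $$ (i,p))"
      by (subst sum.swap) (simp add: mult.commute)
    also have "\<dots> = (\<Sum>s\<in>carrier G. (\<rho> (inv\<^bsub>G\<^esub> s) * \<rho> s) $$ (q,p))"
      using p q rep_carrier[OF rep]
      by (intro sum.cong refl) (simp add: mat_mult_entry[of _ n n _ n])
    also have "\<dots> = (if p = q then of_nat (card (carrier G)) else 0)"
      using p q by (simp add: rep_inv[OF rep])
    finally have "c = (if p = q then of_nat (card (carrier G)) / of_nat n else 0)"
      using n by (auto simp: field_simps)
    then show ?thesis using p q by (simp add: c)
  qed
  have "(\<Sum>s\<in>carrier G. mat_trace (\<rho> s) * mat_trace (\<rho> (inv\<^bsub>G\<^esub> s)))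
      = (\<Sum>p<n. \<Sum>q<n. averaged n n \<rho> \<rho> p q $$ (p,q))"
    by (rule sum_averaged_entries[OF rep rep, symmetric])
  also have "\<dots> = (\<Sum>p<n. \<Sum>q<n. if p = q then of_nat (card (carrier G)) / of_nat n else 0)"
    by (intro sum.cong refl diag) auto
  also have "\<dots> = of_nat (card (carrier G))" using n by simp
  finally show ?thesis .
qed

text \<open>If all averages vanished, so would the inner product of the two characters, which equals
  \<open>c\<close> |G|. \<open>R\<close> may be reducible; the factor \<open>c\<close> will be 1
  when an invariant character is extended and 2 when a restriction to twice a character is
  excluded.\<close>

lemma exists_intertwiner:
  assumes fin: "finite (carrier G)"
    and R: "representation G a R" and irr: "irreducible_representation G b \<rho>"
    and c: "c \<noteq> 0" and tr: "\<And>s. s \<in> carrier G \<Longrightarrow> mat_trace (R s) = c * mat_trace (\<rho> s)"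
  obtains f where "f \<in> carrier_mat a b" "f \<noteq> 0\<^sub>m a b" "\<And>s. s \<in> carrier G \<Longrightarrow> R s * f = f * \<rho> s"
proof -
  have \<rho>: "representation G b \<rho>"
    using irr unfolding irreducible_representation_def by auto
  have "(\<Sum>p<a. \<Sum>q<b. averaged a b R \<rho> p q $$ (p,q)) = c * of_nat (card (carrier G))"
    unfolding sum_averaged_entries[OF R \<rho>] character_norm[OF fin irr, symmetric]
    by (simp add: tr sum_distrib_left mult.assoc)
  also have "\<dots> \<noteq> 0" using c fin one_closed by (auto simp: card_eq_0_iff)
  finally obtain p where p: "p < a" "(\<Sum>q<b. averaged a b R \<rho> p q $$ (p,q)) \<noteq> 0"
    by (metis (no_types, lifting) lessThan_iff sum.not_neutral_contains_not_neutral)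
  then obtain q where q: "q < b" "averaged a b R \<rho> p q $$ (p,q) \<noteq> 0"
    by (metis (no_types, lifting) lessThan_iff sum.not_neutral_contains_not_neutral)
  then have "averaged a b R \<rho> p q \<noteq> 0\<^sub>m a b" using p(1) by auto
  then show ?thesis
    using averaged_intertwines[OF R \<rho> p(1) q(1)] by (intro that[of "averaged a b R \<rho> p q"]) auto
qed

lemma irreducible_intertwiner_inverse:
  assumes irr: "irreducible_representation G n R" and \<rho>: "representation G n \<rho>"
    and f: "f \<in> carrier_mat n n" "f \<noteq> 0\<^sub>m n n" "\<And>s. s \<in> carrier G \<Longrightarrow> R s * f = f * \<rho> s"
  obtains h where "h \<in> carrier_mat n n" "f * h = 1\<^sub>m n" "h * f = 1\<^sub>m n"
proof -
  obtain h where h: "h \<in> carrier_mat n n" "f * h = 1\<^sub>m n"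
    using f rep_carrier[OF \<rho>] by (blast intro: intertwiner_right_inverse[OF G irr f(1,2)])
  then show ?thesis by (intro that[of h] mat_mult_left_right_inverse[OF f(1)])
qed

end

section \<open>Powers of matrices and roots up to a scalar\<close>

lemma pow_mat_add:
  fixes A :: "complex mat"
  assumes "A \<in> carrier_mat n n"
  shows "A ^\<^sub>m (k + l) = A ^\<^sub>m k * A ^\<^sub>m l"
  using assms by (induction l) (simp_all add: assoc_mult_mat[of _ n n _ n _ n] pow_carrier_mat)

lemma pow_mat_mult:
  fixes A :: "complex mat"
  assumes "A \<in> carrier_mat n n"
  shows "A ^\<^sub>m (k * l) = (A ^\<^sub>m k) ^\<^sub>m l"
  using assms
proof (induction l)
  case (Suc l)
  have "A ^\<^sub>m (k * Suc l) = A ^\<^sub>m (k * l + k)" by (simp add: add.commute)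
  with Suc show ?case by (simp only: pow_mat_add pow_mat.simps)
qed simp

lemma pow_mat_smult:
  fixes A :: "complex mat"
  assumes "A \<in> carrier_mat n n"
  shows "(c \<cdot>\<^sub>m A) ^\<^sub>m k = c ^ k \<cdot>\<^sub>m (A ^\<^sub>m k)"
  using assms
proof (induction k)
  case (Suc k)
  then show ?case
    by (auto simp: mult_smult_distrib[of _ n n _ n] mult_smult_assoc_mat[of _ n n _ n] pow_carrier_mat
        mult.commute intro!: eq_matI)
qed (auto intro!: eq_matI)

lemma pow_mat_inverse:
  fixes A B :: "complex mat"
  assumes A: "A \<in> carrier_mat n n" and B: "B \<in> carrier_mat n n" and BA: "B * A = 1\<^sub>m n"
  shows "B ^\<^sub>m k * A ^\<^sub>m k = 1\<^sub>m n"
proof (induction k)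
  case (Suc k)
  have "B ^\<^sub>m Suc k * A ^\<^sub>m Suc k = B ^\<^sub>m (k + 1) * A ^\<^sub>m (1 + k)" by simp
  also have "\<dots> = (B ^\<^sub>m k * B) * (A * A ^\<^sub>m k)"
    using A B by (simp only: pow_mat_add[OF A] pow_mat_add[OF B]) simp
  also have "\<dots> = B ^\<^sub>m k * ((B * A) * A ^\<^sub>m k)"
    using A B by (simp add: assoc_mult_mat[of _ n n _ n _ n] pow_carrier_mat)
  also have "\<dots> = 1\<^sub>m n" using Suc A B unfolding BA by (simp add: pow_carrier_mat)
  finally show ?case .
qed (use A B in simp)

lemma intertwine_pow:
  fixes M :: "complex mat"
  assumes M: "M \<in> carrier_mat n n" and \<rho>: "\<And>s. s \<in> S \<Longrightarrow> \<rho> s \<in> carrier_mat n n"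
    and \<gamma>: "\<And>s. s \<in> S \<Longrightarrow> \<gamma> s \<in> S" and eq: "\<And>s. s \<in> S \<Longrightarrow> M * \<rho> s = \<rho> (\<gamma> s) * M" and s: "s \<in> S"
  shows "M ^\<^sub>m k * \<rho> s = \<rho> ((\<gamma> ^^ k) s) * M ^\<^sub>m k"
  using s
proof (induction k arbitrary: s)
  case 0
  then show ?case
    using M left_mult_one_mat[OF \<rho>[OF 0]] right_mult_one_mat[OF \<rho>[OF 0]] by simp
next
  case (Suc k)
  have gk: "(\<gamma> ^^ k) (\<gamma> s) \<in> S" using Suc.prems \<gamma> by (induction k) auto
  have "M ^\<^sub>m Suc k * \<rho> s = M ^\<^sub>m k * (M * \<rho> s)"
    using M \<rho>[OF Suc.prems] by (simp add: assoc_mult_mat[of _ n n _ n _ n] pow_carrier_mat)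
  also have "\<dots> = (M ^\<^sub>m k * \<rho> (\<gamma> s)) * M"
    using M \<rho>[OF \<gamma>[OF Suc.prems]] unfolding eq[OF Suc.prems] by (simp add: assoc_mult_mat[of _ n n _ n _ n] pow_carrier_mat)
  also have "\<dots> = \<rho> ((\<gamma> ^^ k) (\<gamma> s)) * M ^\<^sub>m Suc k"
    using M \<rho>[OF gk] unfolding Suc.IH[OF \<gamma>[OF Suc.prems]] by (simp add: assoc_mult_mat[of _ n n _ n _ n] pow_carrier_mat)
  finally show ?case by (simp add: funpow_swap1)
qed

text \<open>Moving the k-th power of \<open>M\<close> past \<rho>(s) applies \<gamma> to
  \<open>s\<close> k times, which is conjugation by \<open>u\<close>. So \<rho>(u)\<inverse> times
  this power commutes with \<rho> and is a scalar \<open>d\<close> by Schur, nonzero since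
  \<open>M\<close> is invertible; a k-th root of 1/d is the required factor.\<close>

lemma exists_scaled_root:
  assumes N: "group N" and irr: "irreducible_representation N n \<rho>"
    and M: "M \<in> carrier_mat n n" and M': "M' \<in> carrier_mat n n" and inv: "M' * M = 1\<^sub>m n"
    and \<gamma>: "\<And>s. s \<in> carrier N \<Longrightarrow> \<gamma> s \<in> carrier N"
    and eq: "\<And>s. s \<in> carrier N \<Longrightarrow> M * \<rho> s = \<rho> (\<gamma> s) * M"
    and k: "k > 0" and u: "u \<in> carrier N"
    and conj: "\<And>s. s \<in> carrier N \<Longrightarrow> (\<gamma> ^^ k) s \<otimes>\<^bsub>N\<^esub> u = u \<otimes>\<^bsub>N\<^esub> s"
  obtains c where "c \<noteq> 0" "(c \<cdot>\<^sub>m M) ^\<^sub>m k = \<rho> u"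
proof -
  interpret group N by fact
  have n: "n > 0" and rep: "representation N n \<rho>"
    using irr unfolding irreducible_representation_def by auto
  note c [simp] = rep_carrier[OF N rep] and m = rep_mult[OF N rep]
  have Mk [simp]: "M ^\<^sub>m k \<in> carrier_mat n n" using M by (rule pow_carrier_mat)
  let ?Z = "\<rho> (inv\<^bsub>N\<^esub> u) * M ^\<^sub>m k"
  have "?Z * \<rho> s = \<rho> s * ?Z" if s: "s \<in> carrier N" for s
  proof -
    have gk [simp]: "(\<gamma> ^^ k) s \<in> carrier N" using s \<gamma> by (induction k) auto
    have "(\<gamma> ^^ k) s = u \<otimes>\<^bsub>N\<^esub> s \<otimes>\<^bsub>N\<^esub> inv\<^bsub>N\<^esub> u"
      using conj[OF s] s u by (metis gk inv_solve_right m_closed)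
    then have *: "inv\<^bsub>N\<^esub> u \<otimes>\<^bsub>N\<^esub> (\<gamma> ^^ k) s = s \<otimes>\<^bsub>N\<^esub> inv\<^bsub>N\<^esub> u"
      using s u by (simp add: m_assoc[symmetric])
    have "?Z * \<rho> s = \<rho> (inv\<^bsub>N\<^esub> u) * (M ^\<^sub>m k * \<rho> s)"
      using s u by (simp add: assoc_mult_mat[of _ n n _ n _ n])
    also have "\<dots> = \<rho> (inv\<^bsub>N\<^esub> u) * (\<rho> ((\<gamma> ^^ k) s) * M ^\<^sub>m k)"
      using intertwine_pow[of M n "carrier N" \<rho> \<gamma> s k] M c \<gamma> eq s by simp
    also have "\<dots> = \<rho> (inv\<^bsub>N\<^esub> u \<otimes>\<^bsub>N\<^esub> (\<gamma> ^^ k) s) * M ^\<^sub>m k"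
      using u by (simp add: m assoc_mult_mat[of _ n n _ n _ n])
    also have "\<dots> = \<rho> s * ?Z" unfolding * using s u
      by (simp add: m assoc_mult_mat[of _ n n _ n _ n])
    finally show ?thesis .
  qed
  then obtain d where d: "?Z = d \<cdot>\<^sub>m 1\<^sub>m n"
    using u by (elim schur_scalar[OF N irr, rotated]) (auto intro!: mult_carrier_mat[of _ n n])
  have "M ^\<^sub>m k = \<rho> (u \<otimes>\<^bsub>N\<^esub> inv\<^bsub>N\<^esub> u) * M ^\<^sub>m k" using u by (simp add: rep_one[OF N rep] left_mult_one_mat[OF Mk])
  also have "\<dots> = \<rho> u * ?Z" using u by (simp only: m inv_closed) (simp add: assoc_mult_mat[of _ n n _ n _ n])
  also have "\<dots> = d \<cdot>\<^sub>m \<rho> u" unfolding d using u by (simp add: mult_smult_distrib[of _ n n _ n] right_mult_one_mat[OF c[OF u]])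
  finally have Mk_eq: "M ^\<^sub>m k = d \<cdot>\<^sub>m \<rho> u" .
  have d0: "d \<noteq> 0"
  proof
    assume "d = 0"
    then have "M ^\<^sub>m k = 0\<^sub>m n n" using Mk_eq c[OF u] by (auto intro!: eq_matI)
    then have "0\<^sub>m n n = (1\<^sub>m n :: complex mat)" using pow_mat_inverse[OF M M' inv, of k] M'
      by (simp add: pow_carrier_mat)
    then have "(0\<^sub>m n n :: complex mat) $$ (0,0) = 1\<^sub>m n $$ (0,0)" by (rule arg_cong)
    then show False using n by simp
  qed
  \<comment> \<open>A nonzero complex number has exactly \<open>k\<close> roots of order
    \<open>k\<close>, in particular one.\<close>
  have "card {z::complex. z ^ k = inverse d} \<noteq> 0"
    using card_nth_roots[of "inverse d" k] d0 k by simp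
  then obtain z where z: "z ^ k = inverse d" by (metis (mono_tags, lifting) Collect_empty_eq card.empty)
  have "(z \<cdot>\<^sub>m M) ^\<^sub>m k = \<rho> u"
    using d0 c[OF u] by (auto simp: pow_mat_smult[OF M] z Mk_eq intro!: eq_matI)
  moreover have "z \<noteq> 0" using z d0 k by (auto simp: power_0_left)
  ultimately show ?thesis by (intro that)
qed

section \<open>Extensions with cyclic quotient\<close>

text \<open>Common setting for \<open>H\<close> and the semidirect product: \<open>m\<close> is the
  order of \<open>g\<close> modulo the image of \<open>N\<close>, with (m, u) equal to (2,
  g\<cdot>g) in the first case and (order of \<alpha>, 1) in the second. The embedding \<iota> is
  explicit because the two groups contain \<open>N\<close> differently. Natural exponents suffice in
  \<open>decompose\<close> because a positive power of \<open>g\<close> lies in the image of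
  \<open>N\<close>.\<close>

locale cyclic_extension =
  fixes N :: "('a, 'c) monoid_scheme" and G :: "('b, 'd) monoid_scheme"
    and \<iota> :: "'a \<Rightarrow> 'b" and g :: 'b and \<beta> :: "'a \<Rightarrow> 'a" and m :: nat and u :: 'a
  assumes group_N: "group N" and group_G: "group G" and finite_N: "finite (carrier N)"
    and iota_hom: "\<iota> \<in> hom N G" and iota_inj: "inj_on \<iota> (carrier N)"
    and g_closed: "g \<in> carrier G" and \<beta>_auto: "\<beta> \<in> auto N"
    and conj_g: "\<And>s. s \<in> carrier N \<Longrightarrow> g \<otimes>\<^bsub>G\<^esub> \<iota> s = \<iota> (\<beta> s) \<otimes>\<^bsub>G\<^esub> g"
    and m_pos: "m > 0" and u_closed: "u \<in> carrier N" and g_pow: "g [^]\<^bsub>G\<^esub> m = \<iota> u"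
    and g_pow_mem: "\<And>k::nat. g [^]\<^bsub>G\<^esub> k \<in> \<iota> ` carrier N \<Longrightarrow> m dvd k"
    and decompose: "\<And>x. x \<in> carrier G \<Longrightarrow> \<exists>s\<in>carrier N. \<exists>k::nat. x = \<iota> s \<otimes>\<^bsub>G\<^esub> g [^]\<^bsub>G\<^esub> k"
begin

sublocale N: group N by (rule group_N)
sublocale G: group G by (rule group_G)

lemma iota_closed [simp]: "s \<in> carrier N \<Longrightarrow> \<iota> s \<in> carrier G"
  using iota_hom by (auto simp: hom_def)

lemma iota_mult: "s \<in> carrier N \<Longrightarrow> s' \<in> carrier N \<Longrightarrow> \<iota> (s \<otimes>\<^bsub>N\<^esub> s') = \<iota> s \<otimes>\<^bsub>G\<^esub> \<iota> s'"
  using iota_hom by (auto simp: hom_def)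

lemma iota_one: "\<iota> \<one>\<^bsub>N\<^esub> = \<one>\<^bsub>G\<^esub>"
  using hom_one[OF iota_hom group_N group_G] .

lemma iota_pow: "s \<in> carrier N \<Longrightarrow> \<iota> (s [^]\<^bsub>N\<^esub> (k::nat)) = \<iota> s [^]\<^bsub>G\<^esub> k"
  by (induction k) (simp_all add: iota_one iota_mult)

lemma beta_closed [simp]: "s \<in> carrier N \<Longrightarrow> \<beta> s \<in> carrier N"
  using \<beta>_auto by (auto simp: auto_def hom_def)

lemma beta_pow_closed [simp]: "s \<in> carrier N \<Longrightarrow> (\<beta> ^^ k) s \<in> carrier N"
  by (induction k) auto

lemma beta_mult: "s \<in> carrier N \<Longrightarrow> s' \<in> carrier N \<Longrightarrow> \<beta> (s \<otimes>\<^bsub>N\<^esub> s') = \<beta> s \<otimes>\<^bsub>N\<^esub> \<beta> s'"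
  using \<beta>_auto by (auto simp: auto_def hom_def)

lemma beta_one: "\<beta> \<one>\<^bsub>N\<^esub> = \<one>\<^bsub>N\<^esub>"
  using \<beta>_auto hom_one[OF _ group_N group_N] by (auto simp: auto_def)

lemma beta_bij: "bij_betw \<beta> (carrier N) (carrier N)"
  using \<beta>_auto by (simp add: auto_def Bij_def)

lemma conj_g_pow: "s \<in> carrier N \<Longrightarrow> g [^]\<^bsub>G\<^esub> (k::nat) \<otimes>\<^bsub>G\<^esub> \<iota> s = \<iota> ((\<beta> ^^ k) s) \<otimes>\<^bsub>G\<^esub> g [^]\<^bsub>G\<^esub> k"
proof (induction k arbitrary: s)
  case (Suc k)
  have "g [^]\<^bsub>G\<^esub> Suc k \<otimes>\<^bsub>G\<^esub> \<iota> s = g [^]\<^bsub>G\<^esub> k \<otimes>\<^bsub>G\<^esub> (g \<otimes>\<^bsub>G\<^esub> \<iota> s)"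
    using Suc.prems g_closed by (simp add: G.m_assoc)
  also have "\<dots> = g [^]\<^bsub>G\<^esub> k \<otimes>\<^bsub>G\<^esub> \<iota> (\<beta> s) \<otimes>\<^bsub>G\<^esub> g"
    using Suc.prems g_closed by (simp add: G.m_assoc conj_g)
  also have "\<dots> = \<iota> ((\<beta> ^^ k) (\<beta> s)) \<otimes>\<^bsub>G\<^esub> g [^]\<^bsub>G\<^esub> Suc k"
    using Suc.prems g_closed by (simp add: G.m_assoc Suc.IH)
  finally show ?case by (simp add: funpow_swap1)
qed (simp add: g_closed)

text \<open>\<open>g\<close> commutes with its own power \<open>\<iota> u\<close>.\<close>

lemma beta_u: "\<beta> u = u"
proof -
  have "\<iota> (\<beta> u) \<otimes>\<^bsub>G\<^esub> g = g \<otimes>\<^bsub>G\<^esub> g [^]\<^bsub>G\<^esub> m" using u_closed by (simp add: conj_g g_pow)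
  also have "\<dots> = \<iota> u \<otimes>\<^bsub>G\<^esub> g" using g_closed by (metis G.nat_pow_Suc G.nat_pow_Suc2 g_pow)
  finally have "\<iota> (\<beta> u) = \<iota> u" using u_closed g_closed by simp
  then show ?thesis using iota_inj u_closed by (simp add: inj_on_eq_iff)
qed

text \<open>Conjugation by the m-th power of \<open>g\<close> is conjugation by
  \<open>\<iota> u\<close>; injectivity of \<iota> brings this back to \<open>N\<close>. This is the
  hypothesis \<open>conj\<close> of \<open>exists_scaled_root\<close>.\<close>

lemma beta_pow_m:
  assumes "s \<in> carrier N"
  shows "(\<beta> ^^ m) s \<otimes>\<^bsub>N\<^esub> u = u \<otimes>\<^bsub>N\<^esub> s"
proof -
  have "\<iota> ((\<beta> ^^ m) s \<otimes>\<^bsub>N\<^esub> u) = \<iota> (u \<otimes>\<^bsub>N\<^esub> s)"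
    using conj_g_pow[OF assms, of m] assms u_closed by (simp add: iota_mult g_pow)
  then show ?thesis using iota_inj u_closed assms by (simp add: inj_on_eq_iff)
qed

text \<open>Put R(\<iota>(s) g^k) = \<rho>(s) M^k. Two expressions of one element differ by a power
  of g^m = \<iota>(u), which \<open>M ^\<^sub>m m = \<rho> u\<close> matches; multiplicativity holds
  because \<open>M\<close> moves past \<rho>(s) exactly as \<open>g\<close> moves past
  \<iota>(s).\<close>

lemma extend_representation:
  assumes \<rho>: "representation N n \<rho>" and M: "M \<in> carrier_mat n n"
    and eq: "\<And>s. s \<in> carrier N \<Longrightarrow> M * \<rho> s = \<rho> (\<beta> s) * M" and Mm: "M ^\<^sub>m m = \<rho> u"
  obtains R where "representation G n R" "\<And>s. s \<in> carrier N \<Longrightarrow> R (\<iota> s) = \<rho> s" "R g = M"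
proof -
  note c [simp] = rep_carrier[OF group_N \<rho>] and mult = rep_mult[OF group_N \<rho>]
  have Mk [simp]: "M ^\<^sub>m k \<in> carrier_mat n n" for k using M by (rule pow_carrier_mat)
  note assoc = assoc_mult_mat[of _ n n _ n _ n]
  \<comment> \<open>Exponents are natural numbers, so \<open>l - k\<close> makes sense only for
    \<open>k \<le> l\<close>; the other case follows by symmetry.\<close>
  have wd_le: "\<rho> s * M ^\<^sub>m k = \<rho> s' * M ^\<^sub>m l"
    if s: "s \<in> carrier N" "s' \<in> carrier N" and e: "\<iota> s \<otimes>\<^bsub>G\<^esub> g [^]\<^bsub>G\<^esub> k = \<iota> s' \<otimes>\<^bsub>G\<^esub> g [^]\<^bsub>G\<^esub> l" and kl: "k \<le> l"
    for s s' and k l :: nat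
  proof -
    have "g [^]\<^bsub>G\<^esub> l = g [^]\<^bsub>G\<^esub> (l - k) \<otimes>\<^bsub>G\<^esub> g [^]\<^bsub>G\<^esub> k" using kl g_closed by (simp add: G.nat_pow_mult)
    then have "\<iota> s \<otimes>\<^bsub>G\<^esub> g [^]\<^bsub>G\<^esub> k = (\<iota> s' \<otimes>\<^bsub>G\<^esub> g [^]\<^bsub>G\<^esub> (l - k)) \<otimes>\<^bsub>G\<^esub> g [^]\<^bsub>G\<^esub> k"
      using e s g_closed by (simp add: G.m_assoc)
    then have e': "\<iota> s = \<iota> s' \<otimes>\<^bsub>G\<^esub> g [^]\<^bsub>G\<^esub> (l - k)"
      using s g_closed by simp
    have "\<iota> s' \<otimes>\<^bsub>G\<^esub> \<iota> (inv\<^bsub>N\<^esub> s' \<otimes>\<^bsub>N\<^esub> s) = \<iota> s" using s by (simp add: iota_mult[symmetric] N.m_assoc[symmetric])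
    then have "g [^]\<^bsub>G\<^esub> (l - k) = \<iota> (inv\<^bsub>N\<^esub> s' \<otimes>\<^bsub>N\<^esub> s)" using e' s g_closed
      by (metis G.l_cancel G.nat_pow_closed N.inv_closed N.m_closed iota_closed)
    then have "m dvd l - k" using s by (intro g_pow_mem) auto
    then obtain q where q: "l - k = m * q" by blast
    have "g [^]\<^bsub>G\<^esub> (l - k) = \<iota> (u [^]\<^bsub>N\<^esub> q)"
      using g_closed u_closed by (simp add: q iota_pow g_pow[symmetric] G.nat_pow_pow)
    then have "\<iota> s = \<iota> (s' \<otimes>\<^bsub>N\<^esub> u [^]\<^bsub>N\<^esub> q)" using e' s u_closed by (simp add: iota_mult)
    then have "s = s' \<otimes>\<^bsub>N\<^esub> u [^]\<^bsub>N\<^esub> q" using iota_inj s u_closed by (simp add: inj_on_eq_iff)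
    then have "\<rho> s = \<rho> s' * M ^\<^sub>m (l - k)"
      using s u_closed by (simp add: mult rep_pow[OF group_N \<rho>] q Mm pow_mat_mult[OF M])
    then have "\<rho> s * M ^\<^sub>m k = \<rho> s' * (M ^\<^sub>m (l - k) * M ^\<^sub>m k)" using s by (simp add: assoc)
    also have "M ^\<^sub>m (l - k) * M ^\<^sub>m k = M ^\<^sub>m l" using kl by (simp add: pow_mat_add[OF M, symmetric])
    finally show ?thesis .
  qed
  have wd: "\<rho> s * M ^\<^sub>m k = \<rho> s' * M ^\<^sub>m l"
    if "s \<in> carrier N" "s' \<in> carrier N" "\<iota> s \<otimes>\<^bsub>G\<^esub> g [^]\<^bsub>G\<^esub> k = \<iota> s' \<otimes>\<^bsub>G\<^esub> g [^]\<^bsub>G\<^esub> l"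
    for s s' and k l :: nat
    using wd_le[of s s' k l] wd_le[of s' s l k] that by (cases "k \<le> l") auto
  \<comment> \<open>An arbitrary choice of one expression per element; by \<open>wd\<close> the
    value of \<open>R\<close> can be computed from any other.\<close>
  obtain S K where SK: "\<And>x. x \<in> carrier G \<Longrightarrow> S x \<in> carrier N \<and> x = \<iota> (S x) \<otimes>\<^bsub>G\<^esub> g [^]\<^bsub>G\<^esub> (K x :: nat)"
    using decompose by metis
  define R where "R = (\<lambda>x. \<rho> (S x) * M ^\<^sub>m K x)"
  have R: "R (\<iota> s \<otimes>\<^bsub>G\<^esub> g [^]\<^bsub>G\<^esub> k) = \<rho> s * M ^\<^sub>m k" if s: "s \<in> carrier N" for s and k :: nat
  proof -
    have "\<iota> s \<otimes>\<^bsub>G\<^esub> g [^]\<^bsub>G\<^esub> k \<in> carrier G" using s g_closed by simp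
    from SK[OF this] show ?thesis unfolding R_def using s by (intro wd) auto
  qed
  have R_iota: "R (\<iota> s) = \<rho> s" if "s \<in> carrier N" for s
    using R[OF that, of 0] that M right_mult_one_mat[OF c[OF that]] by simp
  have R_g: "R g = M"
    using R[OF N.one_closed, of 1] M g_closed by (simp add: iota_one rep_one[OF group_N \<rho>])
  have "representation G n R"
    unfolding representation_iff[OF group_G]
  proof (intro conjI ballI)
    fix x assume "x \<in> carrier G"
    then show "R x \<in> carrier_mat n n" using SK[of x] unfolding R_def by (intro mult_carrier_mat[of _ n n]) auto
  next
    fix x y assume "x \<in> carrier G" "y \<in> carrier G"
    then obtain s k s' l where x: "x = \<iota> s \<otimes>\<^bsub>G\<^esub> g [^]\<^bsub>G\<^esub> (k::nat)" "s \<in> carrier N"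
      and y: "y = \<iota> s' \<otimes>\<^bsub>G\<^esub> g [^]\<^bsub>G\<^esub> (l::nat)" "s' \<in> carrier N"
      using decompose by metis
    have "x \<otimes>\<^bsub>G\<^esub> y = \<iota> s \<otimes>\<^bsub>G\<^esub> (g [^]\<^bsub>G\<^esub> k \<otimes>\<^bsub>G\<^esub> \<iota> s') \<otimes>\<^bsub>G\<^esub> g [^]\<^bsub>G\<^esub> l"
      using x y g_closed by (simp add: G.m_assoc)
    also have "\<dots> = \<iota> (s \<otimes>\<^bsub>N\<^esub> (\<beta> ^^ k) s') \<otimes>\<^bsub>G\<^esub> g [^]\<^bsub>G\<^esub> (k + l)"
      using x y g_closed by (simp add: conj_g_pow iota_mult G.m_assoc G.nat_pow_mult[symmetric])
    finally have "R (x \<otimes>\<^bsub>G\<^esub> y) = \<rho> (s \<otimes>\<^bsub>N\<^esub> (\<beta> ^^ k) s') * M ^\<^sub>m (k + l)"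
      using x y by (simp add: R)
    also have "\<dots> = \<rho> s * (\<rho> ((\<beta> ^^ k) s') * M ^\<^sub>m k) * M ^\<^sub>m l"
      using x y by (simp add: mult pow_mat_add[OF M] assoc mult_carrier_mat[of _ n n])
    also have "\<dots> = \<rho> s * (M ^\<^sub>m k * \<rho> s') * M ^\<^sub>m l"
      using intertwine_pow[of M n "carrier N" \<rho> \<beta> s' k] M y eq by simp
    also have "\<dots> = R x * R y"
      using x y by (simp add: R assoc mult_carrier_mat[of _ n n])
    finally show "R (x \<otimes>\<^bsub>G\<^esub> y) = R x * R y" .
  next
    show "R \<one>\<^bsub>G\<^esub> = 1\<^sub>m n" using R_iota[OF N.one_closed] by (simp add: iota_one rep_one[OF group_N \<rho>])
  qed
  with R_iota R_g show ?thesis by (intro that)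
qed

text \<open>\<rho> and \<rho> \<circ> \<beta> have the same character, hence an invertible
  intertwiner, and a suitable multiple of it satisfies the relation g^m = u.\<close>

lemma extend_invariant_representation:
  assumes irr: "irreducible_representation N n \<rho>"
    and inv: "\<And>s. s \<in> carrier N \<Longrightarrow> mat_trace (\<rho> (\<beta> s)) = mat_trace (\<rho> s)"
  obtains R where "irreducible_representation G n R" "\<And>s. s \<in> carrier N \<Longrightarrow> R (\<iota> s) = \<rho> s"
proof -
  have n: "n > 0" and \<rho>: "representation N n \<rho>"
    using irr unfolding irreducible_representation_def by auto
  note c [simp] = rep_carrier[OF group_N \<rho>]
  have \<rho>\<beta>: "representation N n (\<rho> \<circ> \<beta>)"
    unfolding representation_iff[OF group_N] by (simp add: beta_mult beta_one rep_mult[OF group_N \<rho>] rep_one[OF group_N \<rho>])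
  have "mat_trace ((\<rho> \<circ> \<beta>) s) = 1 * mat_trace (\<rho> s)" if "s \<in> carrier N" for s
    using inv[OF that] by simp
  from exists_intertwiner[OF group_N finite_N \<rho>\<beta> irr one_neq_zero this]
  obtain f where f: "f \<in> carrier_mat n n" "f \<noteq> 0\<^sub>m n n" "\<And>s. s \<in> carrier N \<Longrightarrow> \<rho> (\<beta> s) * f = f * \<rho> s"
    unfolding comp_def by blast
  \<comment> \<open>Since \<beta> is onto, the column space of \<open>f\<close>, invariant under
    \<rho> \<circ> \<beta>, is invariant under \<rho>; so irreducibility of \<rho> itself makes
    \<open>f\<close> invertible.\<close>
  have "\<exists>K\<in>carrier_mat n n. \<rho> s * f = f * K" if "s \<in> carrier N" for s
  proof -
    have "s \<in> \<beta> ` carrier N" using beta_bij that by (simp add: bij_betw_def)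
    then obtain s' where s': "s' \<in> carrier N" "s = \<beta> s'" by blast
    show ?thesis
    proof (rule bexI)
      show "\<rho> s * f = f * \<rho> s'" using f(3)[OF s'(1)] s'(2) by simp
    qed (use s'(1) in simp)
  qed
  from intertwiner_right_inverse[OF group_N irr f(1,2) this] obtain h
    where h: "h \<in> carrier_mat n n" "f * h = 1\<^sub>m n" by blast
  have hf: "h * f = 1\<^sub>m n" using mat_mult_left_right_inverse[OF f(1) h] .
  obtain z where z: "z \<noteq> 0" "(z \<cdot>\<^sub>m f) ^\<^sub>m m = \<rho> u"
    by (rule exists_scaled_root[OF group_N irr f(1) h(1) hf beta_closed f(3)[symmetric] m_pos u_closed beta_pow_m])
  have zf: "z \<cdot>\<^sub>m f \<in> carrier_mat n n" using f(1) by simp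
  have "(z \<cdot>\<^sub>m f) * \<rho> s = \<rho> (\<beta> s) * (z \<cdot>\<^sub>m f)" if "s \<in> carrier N" for s
    using f that by (simp add: mult_smult_distrib[of _ n n _ n] mult_smult_assoc_mat[of _ n n _ n])
  then obtain R where R: "representation G n R" "\<And>s. s \<in> carrier N \<Longrightarrow> R (\<iota> s) = \<rho> s" "R g = z \<cdot>\<^sub>m f"
    by (rule extend_representation[OF \<rho> zf _ z(2)]) auto
  \<comment> \<open>A subspace invariant under \<open>G\<close> is invariant under \<open>N\<close>,
    where \<rho> is already irreducible.\<close>
  have "irreducible_representation G n R"
    unfolding irreducible_representation_def
  proof (intro conjI allI impI)
    fix W assume W: "VectorSpace.subspace class_ring W (module_vec TYPE(complex) n) \<and>
      (\<forall>x\<in>carrier G. \<forall>w\<in>W. R x *\<^sub>v w \<in> W)"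
    then have "\<forall>s\<in>carrier N. \<forall>w\<in>W. \<rho> s *\<^sub>v w \<in> W" using R(2) by (metis iota_closed)
    then show "W = {0\<^sub>v n} \<or> W = carrier_vec n"
      using irr W unfolding irreducible_representation_def by blast
  qed (use n R in auto)
  with R(2) show ?thesis by (intro that)
qed

end

section \<open>Eigenvectors of a cyclic action and the exclusion of twice an invariant
  character\<close>

lemma exists_root_of_unity_sum_neq_0:
  fixes x :: "nat \<Rightarrow> complex"
  assumes "m > 0" and x0: "x 0 \<noteq> 0"
  obtains z where "z ^ m = 1" "(\<Sum>k<m. z ^ k * x k) \<noteq> 0"
proof -
  define p where "p = (\<Sum>k<m. monom (x k) k)"
  have "coeff p 0 = x 0" using assms(1) by (simp add: p_def coeff_sum)
  then have p0: "p \<noteq> 0" using x0 by auto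
  have "degree p < m"
    unfolding p_def using assms(1) by (intro degree_sum_less) (auto intro: le_less_trans[OF degree_monom_le])
  \<comment> \<open>A nonzero polynomial of degree below \<open>m\<close> has fewer than
    \<open>m\<close> roots and so cannot vanish at all \<open>m\<close> roots of unity.\<close>
  then have "card {z. poly p z = 0} < card {z::complex. z ^ m = 1}"
    using card_poly_roots_bound[OF p0] by (simp add: card_roots_unity_eq[OF assms(1)])
  then have "\<not> {z::complex. z ^ m = 1} \<subseteq> {z. poly p z = 0}"
    using card_mono[OF poly_roots_finite[OF p0]] by (meson not_le)
  then show ?thesis by (auto simp: p_def poly_sum poly_monom mult.commute intro: that)
qed

text \<open>The discrete Fourier component at \<open>z\<close> of a sequence of matrices over one
  period: when \<open>z ^ m = 1\<close> and the sequence closes up after \<open>m\<close> steps, it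
  is an eigenvector of the shift.\<close>

definition twisted_sum :: "nat \<Rightarrow> nat \<Rightarrow> nat \<Rightarrow> complex \<Rightarrow> (nat \<Rightarrow> complex mat) \<Rightarrow> complex mat" where
  "twisted_sum a b m z F = mat a b (\<lambda>(i,j). \<Sum>k<m. z ^ k * F k $$ (i,j))"

lemma twisted_sum_carrier [simp]: "twisted_sum a b m z F \<in> carrier_mat a b"
  by (simp add: twisted_sum_def)

lemma mult_twisted_sum:
  assumes A: "A \<in> carrier_mat a a" and F: "\<And>k. F k \<in> carrier_mat a b"
  shows "A * twisted_sum a b m z F = twisted_sum a b m z (\<lambda>k. A * F k)"
proof (rule eq_matI)
  fix i j assume "i < dim_row (twisted_sum a b m z (\<lambda>k. A * F k))" "j < dim_col (twisted_sum a b m z (\<lambda>k. A * F k))"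
  then have ij: "i < a" "j < b" by (auto simp: twisted_sum_def)
  have "(A * twisted_sum a b m z F) $$ (i,j) = (\<Sum>l<a. A $$ (i,l) * (\<Sum>k<m. z ^ k * F k $$ (l,j)))"
    using ij A by (subst mat_mult_entry[of _ a a _ b]) (auto simp: twisted_sum_def)
  also have "\<dots> = (\<Sum>k<m. z ^ k * (\<Sum>l<a. A $$ (i,l) * F k $$ (l,j)))"
    by (simp add: sum_distrib_left sum.swap[of _ "{..<a}"] mult.left_commute)
  also have "\<dots> = twisted_sum a b m z (\<lambda>k. A * F k) $$ (i,j)"
    using ij A F by (simp add: twisted_sum_def mat_mult_entry[of _ a a _ b])
  finally show "(A * twisted_sum a b m z F) $$ (i,j) = twisted_sum a b m z (\<lambda>k. A * F k) $$ (i,j)" .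
qed (use A in \<open>auto simp: twisted_sum_def\<close>)

lemma twisted_sum_mult:
  assumes B: "B \<in> carrier_mat b b" and F: "\<And>k. F k \<in> carrier_mat a b"
  shows "twisted_sum a b m z F * B = twisted_sum a b m z (\<lambda>k. F k * B)"
proof (rule eq_matI)
  fix i j assume "i < dim_row (twisted_sum a b m z (\<lambda>k. F k * B))" "j < dim_col (twisted_sum a b m z (\<lambda>k. F k * B))"
  then have ij: "i < a" "j < b" by (auto simp: twisted_sum_def)
  have "(twisted_sum a b m z F * B) $$ (i,j) = (\<Sum>l<b. (\<Sum>k<m. z ^ k * F k $$ (i,l)) * B $$ (l,j))"
    using ij B by (subst mat_mult_entry[of _ a b _ b]) (auto simp: twisted_sum_def)
  also have "\<dots> = (\<Sum>k<m. z ^ k * (\<Sum>l<b. F k $$ (i,l) * B $$ (l,j)))"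
    by (simp add: sum_distrib_left sum_distrib_right sum.swap[of _ "{..<b}"] mult.assoc)
  also have "\<dots> = twisted_sum a b m z (\<lambda>k. F k * B) $$ (i,j)"
    using ij B F by (simp add: twisted_sum_def mat_mult_entry[of _ a b _ b])
  finally show "(twisted_sum a b m z F * B) $$ (i,j) = twisted_sum a b m z (\<lambda>k. F k * B) $$ (i,j)" .
qed (use B in \<open>auto simp: twisted_sum_def\<close>)

text \<open>Shifting the index trades the term at 0 for the term at \<open>m\<close>, and these
  agree by \<open>z\<close> and \<open>per\<close>.\<close>

lemma twisted_sum_shift:
  assumes F: "\<And>k. F k \<in> carrier_mat a b" and z: "z ^ m = 1" and per: "F m = F 0"
  shows "z \<cdot>\<^sub>m twisted_sum a b m z (\<lambda>k. F (Suc k)) = twisted_sum a b m z F"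
proof (rule eq_matI)
  fix i j assume "i < dim_row (twisted_sum a b m z F)" "j < dim_col (twisted_sum a b m z F)"
  then have ij: "i < a" "j < b" by (auto simp: twisted_sum_def)
  have "(\<Sum>k<m. z ^ Suc k * F (Suc k) $$ (i,j)) + F 0 $$ (i,j) = (\<Sum>k<Suc m. z ^ k * F k $$ (i,j))"
    by (subst sum.lessThan_Suc_shift) simp
  also have "\<dots> = (\<Sum>k<m. z ^ k * F k $$ (i,j)) + F 0 $$ (i,j)" by (simp add: z per)
  finally show "(z \<cdot>\<^sub>m twisted_sum a b m z (\<lambda>k. F (Suc k))) $$ (i,j) = twisted_sum a b m z F $$ (i,j)"
    using ij by (simp add: twisted_sum_def sum_distrib_left mult.assoc)
qed (auto simp: twisted_sum_def)

context cyclic_extension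
begin

text \<open>
  A nonzero \<open>N\<close>-intertwiner \<open>f\<close> from an extension \<open>R\<^sub>0\<close> of \<open>\<rho>\<close> to \<open>R\<close> lies in a space on which
  \<open>f \<mapsto> R(g) f R\<^sub>0(g)\<^sup>-\<^sup>1\<close> has finite order; an eigenvector has a \<open>G\<close>-invariant image.
\<close>

lemma irreducible_restriction_not_twice:
  assumes irr: "irreducible_representation N n \<rho>"
    and inv: "\<And>s. s \<in> carrier N \<Longrightarrow> mat_trace (\<rho> (\<beta> s)) = mat_trace (\<rho> s)"
    and irrR: "irreducible_representation G a R"
    and tr: "\<And>s. s \<in> carrier N \<Longrightarrow> mat_trace (R (\<iota> s)) = 2 * mat_trace (\<rho> s)"
  shows False
proof -
  have n: "n > 0" and \<rho>: "representation N n \<rho>" and R: "representation G a R"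
    using irr irrR unfolding irreducible_representation_def by auto
  obtain R0 where irr0: "irreducible_representation G n R0" and R0_iota: "\<And>s. s \<in> carrier N \<Longrightarrow> R0 (\<iota> s) = \<rho> s"
    using irr inv by (rule extend_invariant_representation) auto
  then have R0: "representation G n R0" unfolding irreducible_representation_def by auto
  note c [simp] = rep_carrier[OF group_G R] rep_carrier[OF group_G R0]
    and mult = rep_mult[OF group_G R] and mult0 = rep_mult[OF group_G R0]
  have "of_nat a = (2 * of_nat n :: complex)"
    using tr[OF N.one_closed] by (simp add: iota_one rep_one[OF group_N \<rho>] rep_one[OF group_G R] mat_trace_one)
  then have "of_nat a = (of_nat (2 * n) :: complex)" by simp
  then have a: "a = 2 * n" by (simp only: of_nat_eq_iff)
  have Riota: "representation N a (R \<circ> \<iota>)"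
    unfolding representation_iff[OF group_N] by (simp add: mult iota_mult iota_one rep_one[OF group_G R])
  have tr': "mat_trace ((R \<circ> \<iota>) s) = 2 * mat_trace (\<rho> s)" if "s \<in> carrier N" for s using tr[OF that] by simp
  obtain f where f: "f \<in> carrier_mat a n" "f \<noteq> 0\<^sub>m a n"
    and f_eq: "\<And>s. s \<in> carrier N \<Longrightarrow> (R \<circ> \<iota>) s * f = f * \<rho> s"
    by (rule exists_intertwiner[OF group_N finite_N Riota irr _ tr']) auto
  \<comment> \<open>The k-fold iterate on \<open>f\<close> of the operation f \<mapsto> R(g) f
    R0(g)\<inverse>.\<close>
  define F where "F = (\<lambda>k::nat. R (g [^]\<^bsub>G\<^esub> k) * f * R0 (inv\<^bsub>G\<^esub> (g [^]\<^bsub>G\<^esub> k)))"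
  have gk [simp]: "g [^]\<^bsub>G\<^esub> k \<in> carrier G" for k :: nat using g_closed by simp
  have F_carrier [simp]: "F k \<in> carrier_mat a n" for k
    unfolding F_def using f by (intro mult_carrier_mat[of _ a n] mult_carrier_mat[of _ a a]) auto
  have F_conj: "R x * F k = R (x \<otimes>\<^bsub>G\<^esub> g [^]\<^bsub>G\<^esub> k) * f * R0 (inv\<^bsub>G\<^esub> (g [^]\<^bsub>G\<^esub> k))" if "x \<in> carrier G" for x k
    unfolding F_def using that f by (simp add: mult assoc_mult_mat[of _ a a _ a _ n] assoc_mult_mat[of _ a a _ n _ n] mult_carrier_mat[of _ a a])
  have F_mult: "F k * R0 x = R (g [^]\<^bsub>G\<^esub> k) * f * R0 (inv\<^bsub>G\<^esub> (g [^]\<^bsub>G\<^esub> k) \<otimes>\<^bsub>G\<^esub> x)" if "x \<in> carrier G" for x k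
    unfolding F_def using that f by (simp add: mult0 assoc_mult_mat[of _ a n _ n _ n] mult_carrier_mat[of _ a a])
  \<comment> \<open>Every \<open>F k\<close> is again an intertwiner for \<open>N\<close>, since
    powers of \<open>g\<close> normalise the image of \<open>N\<close>: \<open>s\<close> is the
    image under the k-th power of \<beta> of some \<open>s'\<close>, at which \<open>f\<close>
    intertwines.\<close>
  have F_iota: "R (\<iota> s) * F k = F k * R0 (\<iota> s)" if s: "s \<in> carrier N" for s k
  proof -
    have "bij_betw (\<beta> ^^ k) (carrier N) (carrier N)" using beta_bij by (rule bij_betw_funpow)
    then have "s \<in> (\<beta> ^^ k) ` carrier N" using s by (simp add: bij_betw_def)
    then obtain s' where s': "s' \<in> carrier N" "(\<beta> ^^ k) s' = s" by blast
    have comm: "\<iota> s \<otimes>\<^bsub>G\<^esub> g [^]\<^bsub>G\<^esub> k = g [^]\<^bsub>G\<^esub> k \<otimes>\<^bsub>G\<^esub> \<iota> s'" using conj_g_pow[OF s'(1), of k] s' by simp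
    have "inv\<^bsub>G\<^esub> (g [^]\<^bsub>G\<^esub> k) \<otimes>\<^bsub>G\<^esub> (\<iota> s \<otimes>\<^bsub>G\<^esub> g [^]\<^bsub>G\<^esub> k) = \<iota> s'"
      unfolding comm using s' by (simp add: G.m_assoc[symmetric])
    then have comm': "\<iota> s' \<otimes>\<^bsub>G\<^esub> inv\<^bsub>G\<^esub> (g [^]\<^bsub>G\<^esub> k) = inv\<^bsub>G\<^esub> (g [^]\<^bsub>G\<^esub> k) \<otimes>\<^bsub>G\<^esub> \<iota> s"
      using s s' by (metis G.inv_closed G.inv_solve_right G.m_assoc G.m_closed gk iota_closed)
    have "R (\<iota> s) * F k = R (g [^]\<^bsub>G\<^esub> k) * (R (\<iota> s') * f) * R0 (inv\<^bsub>G\<^esub> (g [^]\<^bsub>G\<^esub> k))"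
      using s s' f unfolding F_conj[OF iota_closed[OF s]] comm
      by (simp add: mult assoc_mult_mat[of _ a a _ a _ n])
    also have "\<dots> = R (g [^]\<^bsub>G\<^esub> k) * (f * R0 (\<iota> s')) * R0 (inv\<^bsub>G\<^esub> (g [^]\<^bsub>G\<^esub> k))"
      using f_eq[OF s'(1)] s' by (simp add: R0_iota)
    also have "\<dots> = R (g [^]\<^bsub>G\<^esub> k) * f * R0 (\<iota> s' \<otimes>\<^bsub>G\<^esub> inv\<^bsub>G\<^esub> (g [^]\<^bsub>G\<^esub> k))"
    proof -
      have "R (g [^]\<^bsub>G\<^esub> k) * (f * R0 (\<iota> s')) * R0 (inv\<^bsub>G\<^esub> (g [^]\<^bsub>G\<^esub> k))
        = R (g [^]\<^bsub>G\<^esub> k) * f * R0 (\<iota> s') * R0 (inv\<^bsub>G\<^esub> (g [^]\<^bsub>G\<^esub> k))"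
        using s' f by (subst assoc_mult_mat[of _ a a f n _ n]) auto
      also have "\<dots> = R (g [^]\<^bsub>G\<^esub> k) * f * (R0 (\<iota> s') * R0 (inv\<^bsub>G\<^esub> (g [^]\<^bsub>G\<^esub> k)))"
        using s' f by (subst assoc_mult_mat[of _ a n _ n _ n]) (auto intro: mult_carrier_mat[of _ a a])
      finally show ?thesis using s' by (simp add: mult0)
    qed
    finally show ?thesis using s unfolding comm' by (simp add: F_mult)
  qed
  have F_Suc: "R g * F k = F (Suc k) * R0 g" for k
  proof -
    have p: "g [^]\<^bsub>G\<^esub> Suc k = g \<otimes>\<^bsub>G\<^esub> g [^]\<^bsub>G\<^esub> k" using g_closed by (rule G.nat_pow_Suc2)
    have "inv\<^bsub>G\<^esub> (g [^]\<^bsub>G\<^esub> Suc k) \<otimes>\<^bsub>G\<^esub> g = inv\<^bsub>G\<^esub> (g [^]\<^bsub>G\<^esub> k)"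
      unfolding p using g_closed by (simp add: G.inv_mult_group G.m_assoc)
    then show ?thesis unfolding F_conj[OF g_closed] F_mult[OF g_closed] by (simp only: p)
  qed
  have F_0: "F 0 = f" unfolding F_def using f by (simp add: rep_one[OF group_G R] rep_one[OF group_G R0])
  \<comment> \<open>The m-th power of \<open>g\<close> is \<open>\<iota> u\<close>, and
    \<open>f\<close> intertwines at \<open>u\<close>, so the two outer factors cancel.\<close>
  have F_m: "F m = F 0"
  proof -
    have "F m = f * R0 (\<iota> u) * R0 (inv\<^bsub>G\<^esub> (\<iota> u))"
      unfolding F_def using f_eq[OF u_closed] u_closed by (simp add: g_pow R0_iota)
    also have "\<dots> = f * (R0 (\<iota> u) * R0 (inv\<^bsub>G\<^esub> (\<iota> u)))"
      using f u_closed by (simp add: assoc_mult_mat[of _ a n _ n _ n])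
    also have "\<dots> = f" using f u_closed by (simp add: rep_inv[OF group_G R0])
    finally show ?thesis using F_0 by simp
  qed
  from f obtain i j where ij: "i < a" "j < n" "f $$ (i,j) \<noteq> 0"
    by (metis carrier_matD eq_matI index_zero_mat)
  \<comment> \<open>\<open>z\<close> is chosen so that \<open>E\<close> does not vanish at an entry
    where \<open>F 0 = f\<close> does not.\<close>
  obtain z where z: "z ^ m = 1" "(\<Sum>k<m. z ^ k * F k $$ (i,j)) \<noteq> 0"
    by (rule exists_root_of_unity_sum_neq_0[OF m_pos, of "\<lambda>k. F k $$ (i,j)"]) (use ij F_0 in auto)
  have z0: "z \<noteq> 0" using z(1) m_pos by (auto simp: power_0_left)
  define E where "E = twisted_sum a n m z F"
  have E [simp]: "E \<in> carrier_mat a n" by (simp add: E_def)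
  have "E $$ (i,j) \<noteq> 0" using z ij by (simp add: E_def twisted_sum_def)
  then have E0: "E \<noteq> 0\<^sub>m a n" using ij by auto
  have E_iota: "R (\<iota> s) * E = E * \<rho> s" if "s \<in> carrier N" for s
    unfolding E_def using that
    by (simp add: mult_twisted_sum F_iota twisted_sum_mult R0_iota[symmetric])
  \<comment> \<open>\<open>R g\<close> shifts the sequence \<open>F\<close>, so \<open>E\<close>
    intertwines \<open>R g\<close> with \<open>R0 g\<close> up to the scalar 1/z. Hence the column
    space of \<open>E\<close> is invariant under all of \<open>G\<close>.\<close>
  have E_g: "R g * E = E * (inverse z \<cdot>\<^sub>m R0 g)"
  proof -
    have "R g * E = twisted_sum a n m z (\<lambda>k. F (Suc k)) * R0 g"
      unfolding E_def using g_closed by (simp add: mult_twisted_sum F_Suc twisted_sum_mult)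
    also have "twisted_sum a n m z (\<lambda>k. F (Suc k)) = inverse z \<cdot>\<^sub>m E"
      unfolding E_def twisted_sum_shift[of F, OF F_carrier z(1) F_m, symmetric]
      using z0 by (intro eq_matI) (auto simp: twisted_sum_def)
    finally show ?thesis using g_closed
      by (simp add: mult_smult_distrib[of _ a n _ n] mult_smult_assoc_mat[of _ a n _ n])
  qed
  have E_pow: "\<exists>K\<in>carrier_mat n n. R (g [^]\<^bsub>G\<^esub> k) * E = E * K" for k :: nat
  proof (induction k)
    case 0
    show ?case by (rule bexI[of _ "1\<^sub>m n"]) (simp_all add: rep_one[OF group_G R] left_mult_one_mat[OF E] right_mult_one_mat[OF E])
  next
    case (Suc k)
    then obtain K where K: "K \<in> carrier_mat n n" "R (g [^]\<^bsub>G\<^esub> k) * E = E * K" by blast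
    let ?L = "inverse z \<cdot>\<^sub>m R0 g"
    have L: "?L \<in> carrier_mat n n" using g_closed by simp
    have "R (g [^]\<^bsub>G\<^esub> Suc k) * E = R (g [^]\<^bsub>G\<^esub> k) * (R g * E)"
      using g_closed by (simp add: mult assoc_mult_mat[of _ a a _ a _ n])
    also have "\<dots> = (R (g [^]\<^bsub>G\<^esub> k) * E) * ?L"
      unfolding E_g by (rule assoc_mult_mat[symmetric, of _ a a _ n _ n]) (use L in auto)
    also have "\<dots> = E * (K * ?L)"
      unfolding K(2) by (rule assoc_mult_mat[of _ a n _ n _ n]) (use L K in auto)
    finally show ?case using K L by (intro bexI[of _ "K * ?L"]) auto
  qed
  have "\<exists>K\<in>carrier_mat n n. R x * E = E * K" if "x \<in> carrier G" for x
  proof -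
    obtain s k where x: "x = \<iota> s \<otimes>\<^bsub>G\<^esub> g [^]\<^bsub>G\<^esub> (k::nat)" "s \<in> carrier N"
      using decompose \<open>x \<in> carrier G\<close> by metis
    obtain K where K: "K \<in> carrier_mat n n" "R (g [^]\<^bsub>G\<^esub> k) * E = E * K" using E_pow by blast
    have \<rho>s: "\<rho> s \<in> carrier_mat n n" using rep_carrier[OF group_N \<rho> x(2)] .
    have "R x * E = R (\<iota> s) * (R (g [^]\<^bsub>G\<^esub> k) * E)"
      using x by (simp add: mult assoc_mult_mat[of _ a a _ a _ n])
    also have "\<dots> = (R (\<iota> s) * E) * K"
      unfolding K(2) by (rule assoc_mult_mat[symmetric, of _ a a _ n _ n]) (use x K in auto)
    also have "\<dots> = E * (\<rho> s * K)"
      unfolding E_iota[OF x(2)] by (rule assoc_mult_mat[of _ a n _ n _ n]) (use \<rho>s K in auto)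
    finally show ?thesis using K \<rho>s by (intro bexI[of _ "\<rho> s * K"]) auto
  qed
  \<comment> \<open>By irreducibility of \<open>R\<close> the \<open>n\<close> columns of
    \<open>E\<close> span a space of dimension 2n, which is absurd for \<open>n > 0\<close>.\<close>
  from intertwiner_right_inverse[OF group_G irrR E E0 this] obtain h
    where "h \<in> carrier_mat n a" "E * h = 1\<^sub>m a" by blast
  from right_invertible_dim_le[OF E this] show False using a n by simp
qed

end

section \<open>Invariant subspaces of a direct sum of two irreducible representations\<close>

lemma unit_vecs_generate:
  fixes W :: "complex vec set"
  assumes "W \<subseteq> carrier_vec n" "0\<^sub>v n \<in> W"
    and add: "\<And>v w. v \<in> W \<Longrightarrow> w \<in> W \<Longrightarrow> v + w \<in> W" and smult: "\<And>c v. v \<in> W \<Longrightarrow> c \<cdot>\<^sub>v v \<in> W"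
    and unit: "\<And>i. i < n \<Longrightarrow> unit_vec n i \<in> W"
  shows "W = carrier_vec n"
proof -
  have "v \<in> W" if v: "v \<in> carrier_vec n" for v
  proof -
    \<comment> \<open>Induction over truncations of \<open>v\<close>: each step adds one multiple of
      a unit vector.\<close>
    have "vec n (\<lambda>i. if i < k then v $ i else 0) \<in> W" if "k \<le> n" for k
      using that
    proof (induction k)
      case 0
      have "vec n (\<lambda>i. if i < 0 then v $ i else 0) = 0\<^sub>v n" by (intro eq_vecI) auto
      with assms(2) show ?case by simp
    next
      case (Suc k)
      have "vec n (\<lambda>i. if i < Suc k then v $ i else 0)
        = vec n (\<lambda>i. if i < k then v $ i else 0) + v $ k \<cdot>\<^sub>v unit_vec n k"
        using Suc.prems by (intro eq_vecI) (auto simp: less_Suc_eq)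
      with Suc show ?case by (simp add: add smult unit)
    qed
    from this[of n] have "vec n (\<lambda>i. if i < n then v $ i else 0) \<in> W" by simp
    also have "vec n (\<lambda>i. if i < n then v $ i else 0) = v" using v by (intro eq_vecI) auto
    finally show ?thesis .
  qed
  with assms(1) show ?thesis by auto
qed

lemma append_vec_smult:
  fixes c :: complex
  shows "c \<cdot>\<^sub>v (v @\<^sub>v w) = (c \<cdot>\<^sub>v v) @\<^sub>v (c \<cdot>\<^sub>v w)"
  by (intro eq_vecI) auto

lemma append_zero_vec: "0\<^sub>v n @\<^sub>v 0\<^sub>v k = (0\<^sub>v (n + k) :: complex vec)"
  by (intro eq_vecI) auto

lemma carrier_append_vecE:
  assumes "x \<in> carrier_vec (n + k)"
  obtains v w where "v \<in> carrier_vec n" "w \<in> carrier_vec k" "x = v @\<^sub>v w"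
  using assms vec_first_last_append[OF assms] by (metis vec_first_carrier vec_last_carrier)

text \<open>Choose a partner in \<open>W\<close> for every unit vector and take these as the columns
  of \<open>F\<close>; the vectors whose graph point lies in \<open>W\<close> form a subspace
  containing all unit vectors. No uniqueness of partners is assumed.\<close>

lemma subspace_graph_matrix:
  fixes W :: "complex vec set"
  assumes W: "W \<subseteq> carrier_vec (n + k)" "0\<^sub>v (n + k) \<in> W"
    and add: "\<And>v w. v \<in> W \<Longrightarrow> w \<in> W \<Longrightarrow> v + w \<in> W" and smult: "\<And>c v. v \<in> W \<Longrightarrow> c \<cdot>\<^sub>v v \<in> W"
    and total: "\<And>v. v \<in> carrier_vec n \<Longrightarrow> \<exists>w\<in>carrier_vec k. v @\<^sub>v w \<in> W"
  obtains F where "F \<in> carrier_mat k n" "\<And>v. v \<in> carrier_vec n \<Longrightarrow> v @\<^sub>v F *\<^sub>v v \<in> W"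
proof -
  have "\<exists>w. w \<in> carrier_vec k \<and> unit_vec n j @\<^sub>v w \<in> W" for j using total[of "unit_vec n j"] by auto
  then obtain w where w: "\<And>j. w j \<in> carrier_vec k" "\<And>j. unit_vec n j @\<^sub>v w j \<in> W" by metis
  define F where "F = mat k n (\<lambda>(i,j). w j $ i)"
  have F: "F \<in> carrier_mat k n" by (simp add: F_def)
  have Fu: "F *\<^sub>v unit_vec n j = w j" if "j < n" for j
    using that w(1)[of j] by (intro eq_vecI) (auto simp: F_def)
  have "{v \<in> carrier_vec n. v @\<^sub>v F *\<^sub>v v \<in> W} = carrier_vec n"
  proof (rule unit_vecs_generate)
    have "F *\<^sub>v 0\<^sub>v n = 0\<^sub>v k" using F by auto
    then show "0\<^sub>v n \<in> {v \<in> carrier_vec n. v @\<^sub>v F *\<^sub>v v \<in> W}" using W(2) by (simp add: append_zero_vec)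
  next
    fix v v' assume v: "v \<in> {v \<in> carrier_vec n. v @\<^sub>v F *\<^sub>v v \<in> W}" "v' \<in> {v \<in> carrier_vec n. v @\<^sub>v F *\<^sub>v v \<in> W}"
    have Fv: "F *\<^sub>v v \<in> carrier_vec k" "F *\<^sub>v v' \<in> carrier_vec k" using F v by auto
    have "(v @\<^sub>v F *\<^sub>v v) + (v' @\<^sub>v F *\<^sub>v v') = (v + v') @\<^sub>v F *\<^sub>v (v + v')"
      using v F append_vec_add[OF _ _ Fv, of v n v'] by (simp add: mult_add_distrib_mat_vec[OF F])
    then show "v + v' \<in> {v \<in> carrier_vec n. v @\<^sub>v F *\<^sub>v v \<in> W}" using add v by (metis (no_types, lifting) add_carrier_vec mem_Collect_eq)
  next
    fix c v assume v: "v \<in> {v \<in> carrier_vec n. v @\<^sub>v F *\<^sub>v v \<in> W}"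
    have "c \<cdot>\<^sub>v (v @\<^sub>v F *\<^sub>v v) = (c \<cdot>\<^sub>v v) @\<^sub>v F *\<^sub>v (c \<cdot>\<^sub>v v)"
      using v F by (simp add: append_vec_smult mult_mat_vec[OF F])
    then show "c \<cdot>\<^sub>v v \<in> {v \<in> carrier_vec n. v @\<^sub>v F *\<^sub>v v \<in> W}" using smult v by (metis (no_types, lifting) smult_carrier_vec mem_Collect_eq)
  qed (use w Fu in auto)
  then show ?thesis using F by (intro that[of F]) auto
qed

text \<open>
  A nonzero invariant \<open>W\<close> containing neither summand meets both trivially, so it is the graph of an
  isomorphism between them (Goursat), which would force equal traces.
\<close>

lemma invariant_subspace_direct_sum:
  assumes N: "group N"
    and irr: "irreducible_representation N n \<rho>" and irr': "irreducible_representation N n \<rho>'"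
    and ne: "s0 \<in> carrier N" "mat_trace (\<rho> s0) \<noteq> mat_trace (\<rho>' s0)"
    and W: "W \<subseteq> carrier_vec (n + n)" "0\<^sub>v (n + n) \<in> W"
    and add: "\<And>v w. v \<in> W \<Longrightarrow> w \<in> W \<Longrightarrow> v + w \<in> W" and smult: "\<And>c v. v \<in> W \<Longrightarrow> c \<cdot>\<^sub>v v \<in> W"
    and inv: "\<And>s v w. s \<in> carrier N \<Longrightarrow> v \<in> carrier_vec n \<Longrightarrow> w \<in> carrier_vec n \<Longrightarrow> v @\<^sub>v w \<in> W \<Longrightarrow>
      (\<rho> s *\<^sub>v v) @\<^sub>v (\<rho>' s *\<^sub>v w) \<in> W"
  shows "W = {0\<^sub>v (n + n)} \<or> (\<forall>v\<in>carrier_vec n. v @\<^sub>v 0\<^sub>v n \<in> W) \<or> (\<forall>v\<in>carrier_vec n. 0\<^sub>v n @\<^sub>v v \<in> W)"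
proof (rule ccontr)
  assume contra: "\<not> ?thesis"
  have n: "n > 0" and rep: "representation N n \<rho>" and rep': "representation N n \<rho>'"
    using irr irr' unfolding irreducible_representation_def by auto
  note c [simp] = rep_carrier[OF N rep] rep_carrier[OF N rep']
  have [simp]: "c \<cdot>\<^sub>v 0\<^sub>v n = 0\<^sub>v n" for c :: complex by (intro eq_vecI) auto
  have neg: "x + (-1) \<cdot>\<^sub>v x = 0\<^sub>v n" if "x \<in> carrier_vec n" for x :: "complex vec"
    using that by (intro eq_vecI) auto
  have zero [simp]: "A *\<^sub>v 0\<^sub>v n = 0\<^sub>v n" if "A \<in> carrier_mat n n" for A :: "complex mat" using that by auto
  have add': "(v + v') @\<^sub>v (w + w') \<in> W"
    if "v \<in> carrier_vec n" "v' \<in> carrier_vec n" "w \<in> carrier_vec n" "w' \<in> carrier_vec n" "v @\<^sub>v w \<in> W" "v' @\<^sub>v w' \<in> W" for v v' w w'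
    using add[OF that(5,6)] append_vec_add[OF that(1-4)] by simp
  have smult': "(c \<cdot>\<^sub>v v) @\<^sub>v (c \<cdot>\<^sub>v w) \<in> W" if "v @\<^sub>v w \<in> W" for c v w
    using smult[OF that, of c] by (simp add: append_vec_smult)
  have "{v \<in> carrier_vec n. v @\<^sub>v 0\<^sub>v n \<in> W} = {0\<^sub>v n} \<or> {v \<in> carrier_vec n. v @\<^sub>v 0\<^sub>v n \<in> W} = carrier_vec n"
  proof (rule irreducible_invariant_subspace[OF irr])
    fix v w assume "v \<in> {v \<in> carrier_vec n. v @\<^sub>v 0\<^sub>v n \<in> W}" "w \<in> {v \<in> carrier_vec n. v @\<^sub>v 0\<^sub>v n \<in> W}"
    then show "v + w \<in> {v \<in> carrier_vec n. v @\<^sub>v 0\<^sub>v n \<in> W}" using add'[of v w "0\<^sub>v n" "0\<^sub>v n"] by simp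
  next
    fix c v assume "v \<in> {v \<in> carrier_vec n. v @\<^sub>v 0\<^sub>v n \<in> W}"
    then show "c \<cdot>\<^sub>v v \<in> {v \<in> carrier_vec n. v @\<^sub>v 0\<^sub>v n \<in> W}" using smult'[of v "0\<^sub>v n" c] by simp
  next
    fix s v assume "s \<in> carrier N" "v \<in> {v \<in> carrier_vec n. v @\<^sub>v 0\<^sub>v n \<in> W}"
    then show "\<rho> s *\<^sub>v v \<in> {v \<in> carrier_vec n. v @\<^sub>v 0\<^sub>v n \<in> W}"
      using inv[of s v "0\<^sub>v n"] mult_mat_vec_carrier[of "\<rho> s" n n v] by simp
  qed (use W(2) in \<open>auto simp: append_zero_vec\<close>)
  \<comment> \<open>The intersection with the first summand is invariant, and it is not the whole
    summand by \<open>contra\<close>; \<open>right\<close> below is the same for the second.\<close>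
  with contra have left: "v = 0\<^sub>v n" if "v \<in> carrier_vec n" "v @\<^sub>v 0\<^sub>v n \<in> W" for v
    using that by blast
  have "{v \<in> carrier_vec n. 0\<^sub>v n @\<^sub>v v \<in> W} = {0\<^sub>v n} \<or> {v \<in> carrier_vec n. 0\<^sub>v n @\<^sub>v v \<in> W} = carrier_vec n"
  proof (rule irreducible_invariant_subspace[OF irr'])
    fix v w assume "v \<in> {v \<in> carrier_vec n. 0\<^sub>v n @\<^sub>v v \<in> W}" "w \<in> {v \<in> carrier_vec n. 0\<^sub>v n @\<^sub>v v \<in> W}"
    then show "v + w \<in> {v \<in> carrier_vec n. 0\<^sub>v n @\<^sub>v v \<in> W}" using add'[of "0\<^sub>v n" "0\<^sub>v n" v w] by simp
  next
    fix c v assume "v \<in> {v \<in> carrier_vec n. 0\<^sub>v n @\<^sub>v v \<in> W}"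
    then show "c \<cdot>\<^sub>v v \<in> {v \<in> carrier_vec n. 0\<^sub>v n @\<^sub>v v \<in> W}" using smult'[of "0\<^sub>v n" v c] by simp
  next
    fix s v assume "s \<in> carrier N" "v \<in> {v \<in> carrier_vec n. 0\<^sub>v n @\<^sub>v v \<in> W}"
    then show "\<rho>' s *\<^sub>v v \<in> {v \<in> carrier_vec n. 0\<^sub>v n @\<^sub>v v \<in> W}"
      using inv[of s "0\<^sub>v n" v] mult_mat_vec_carrier[of "\<rho>' s" n n v] by simp
  qed (use W(2) in \<open>auto simp: append_zero_vec\<close>)
  with contra have right: "v = 0\<^sub>v n" if "v \<in> carrier_vec n" "0\<^sub>v n @\<^sub>v v \<in> W" for v
    using that by blast
  \<comment> \<open>The projection of \<open>W\<close> to the first summand. It is invariant, and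
    were it zero, \<open>right\<close> would make \<open>W\<close> zero; so it is
    everything.\<close>
  let ?P = "{v \<in> carrier_vec n. \<exists>w\<in>carrier_vec n. v @\<^sub>v w \<in> W}"
  have "?P = {0\<^sub>v n} \<or> ?P = carrier_vec n"
  proof (rule irreducible_invariant_subspace[OF irr])
    show "0\<^sub>v n \<in> ?P" using W(2) by (auto simp: append_zero_vec intro!: bexI[of _ "0\<^sub>v n"])
  next
    fix v v' assume "v \<in> ?P" "v' \<in> ?P"
    then obtain w w' where w: "w \<in> carrier_vec n" "w' \<in> carrier_vec n" "v @\<^sub>v w \<in> W" "v' @\<^sub>v w' \<in> W"
      and v: "v \<in> carrier_vec n" "v' \<in> carrier_vec n" by blast
    from add'[OF v w] show "v + v' \<in> ?P" using v w by (auto intro!: bexI[of _ "w + w'"])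
  next
    fix c v assume "v \<in> ?P"
    then obtain w where w: "w \<in> carrier_vec n" "v @\<^sub>v w \<in> W" "v \<in> carrier_vec n" by blast
    from smult'[OF w(2), of c] show "c \<cdot>\<^sub>v v \<in> ?P" using w by (auto intro!: bexI[of _ "c \<cdot>\<^sub>v w"])
  next
    fix s v assume s: "s \<in> carrier N" and "v \<in> ?P"
    then obtain w where w: "w \<in> carrier_vec n" "v @\<^sub>v w \<in> W" "v \<in> carrier_vec n" by blast
    from inv[OF s w(3,1,2)] show "\<rho> s *\<^sub>v v \<in> ?P"
      using mult_mat_vec_carrier[OF c(1)[OF s] w(3)] mult_mat_vec_carrier[OF c(2)[OF s] w(1)] by blast
  qed auto
  moreover have "?P \<noteq> {0\<^sub>v n}"
  proof
    assume P: "?P = {0\<^sub>v n}"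
    have "x = 0\<^sub>v (n + n)" if x: "x \<in> W" for x
    proof -
      from x W(1) obtain v w where vw: "v \<in> carrier_vec n" "w \<in> carrier_vec n" "x = v @\<^sub>v w"
        by (meson carrier_append_vecE subsetD)
      then have "v = 0\<^sub>v n" using P x by blast
      with right[of w] vw x show ?thesis by (simp add: append_zero_vec)
    qed
    with W(2) contra show False by blast
  qed
  ultimately have total: "\<And>v. v \<in> carrier_vec n \<Longrightarrow> \<exists>w\<in>carrier_vec n. v @\<^sub>v w \<in> W" by blast
  obtain F where F: "F \<in> carrier_mat n n" and graph: "\<And>v. v \<in> carrier_vec n \<Longrightarrow> v @\<^sub>v F *\<^sub>v v \<in> W"
    by (rule subspace_graph_matrix[OF W add smult total]) blast+
  have F_eq: "\<rho>' s * F = F * \<rho> s" if s: "s \<in> carrier N" for s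
  proof (rule mat_eq_by_vecI[of _ n n])
    fix v :: "complex vec" assume v: "v \<in> carrier_vec n"
    have Fv: "F *\<^sub>v v \<in> carrier_vec n" and \<rho>v: "\<rho> s *\<^sub>v v \<in> carrier_vec n"
      using F v s by (auto intro: mult_mat_vec_carrier[of _ n n])
    have a: "\<rho>' s *\<^sub>v (F *\<^sub>v v) \<in> carrier_vec n" and b: "F *\<^sub>v (\<rho> s *\<^sub>v v) \<in> carrier_vec n"
      using F Fv \<rho>v s by (auto intro: mult_mat_vec_carrier[of _ n n])
    \<comment> \<open>Two elements of \<open>W\<close> over the same first component are subtracted:
      the translate by \<open>s\<close> of the graph point of \<open>v\<close>, and the graph point
      of \<rho>(s) v. Their difference lies in the second summand and vanishes by
      \<open>right\<close>, so \<open>F\<close> intertwines.\<close>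
    have "(\<rho> s *\<^sub>v v + (-1) \<cdot>\<^sub>v (\<rho> s *\<^sub>v v)) @\<^sub>v (\<rho>' s *\<^sub>v (F *\<^sub>v v) + (-1) \<cdot>\<^sub>v (F *\<^sub>v (\<rho> s *\<^sub>v v))) \<in> W"
      using \<rho>v a b by (intro add' inv s v Fv graph smult') auto
    moreover have "\<rho> s *\<^sub>v v + (-1) \<cdot>\<^sub>v (\<rho> s *\<^sub>v v) = 0\<^sub>v n" using \<rho>v by (rule neg)
    ultimately have z: "\<rho>' s *\<^sub>v (F *\<^sub>v v) + (-1) \<cdot>\<^sub>v (F *\<^sub>v (\<rho> s *\<^sub>v v)) = 0\<^sub>v n"
      using a b by (intro right) auto
    have "\<rho>' s *\<^sub>v (F *\<^sub>v v) = F *\<^sub>v (\<rho> s *\<^sub>v v)"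
    proof (rule eq_vecI)
      fix i assume "i < dim_vec (F *\<^sub>v (\<rho> s *\<^sub>v v))"
      then have i: "i < n" using F by simp
      have "(\<rho>' s *\<^sub>v (F *\<^sub>v v) + (-1) \<cdot>\<^sub>v (F *\<^sub>v (\<rho> s *\<^sub>v v))) $ i = 0" using z i by simp
      moreover have "(\<rho>' s *\<^sub>v (F *\<^sub>v v) + (-1) \<cdot>\<^sub>v (F *\<^sub>v (\<rho> s *\<^sub>v v))) $ i
         = (\<rho>' s *\<^sub>v (F *\<^sub>v v)) $ i - (F *\<^sub>v (\<rho> s *\<^sub>v v)) $ i"
        using i carrier_vecD[OF a] carrier_vecD[OF b] by (simp del: index_mult_mat_vec)
      ultimately show "(\<rho>' s *\<^sub>v (F *\<^sub>v v)) $ i = (F *\<^sub>v (\<rho> s *\<^sub>v v)) $ i" by simp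
    qed (use carrier_vecD[OF a] carrier_vecD[OF b] in simp)
    then show "(\<rho>' s * F) *\<^sub>v v = (F * \<rho> s) *\<^sub>v v"
      using assoc_mult_mat_vec[OF c(2)[OF s] F v] assoc_mult_mat_vec[OF F c(1)[OF s] v] by simp
  qed (use F s in \<open>auto intro!: mult_carrier_mat[of _ n n]\<close>)
  \<comment> \<open>\<open>F = 0\<close> would put a nonzero vector of the first summand into
    \<open>W\<close>, against \<open>left\<close>.\<close>
  have "F \<noteq> 0\<^sub>m n n"
  proof
    assume "F = 0\<^sub>m n n"
    then have "unit_vec n 0 @\<^sub>v 0\<^sub>v n \<in> W" using graph[of "unit_vec n 0"] by (simp add: zero_mat_mult_vec)
    then have "unit_vec n 0 = (0\<^sub>v n :: complex vec)" by (intro left) auto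
    then show False using n by simp
  qed
  from irreducible_intertwiner_inverse[OF N irr' rep F this F_eq] obtain h
    where "h \<in> carrier_mat n n" "F * h = 1\<^sub>m n" "h * F = 1\<^sub>m n" by blast
  then have "mat_trace (\<rho>' s0) = mat_trace (\<rho> s0)"
    using F ne(1) by (intro mat_trace_conjugate[of F n h]) (auto simp: F_eq)
  with ne show False by simp
qed

section \<open>Block matrices and the module with two swapped summands\<close>

lemma four_block_diag_carrier:
  "A \<in> carrier_mat n n \<Longrightarrow> B \<in> carrier_mat n n \<Longrightarrow> four_block_mat A (0\<^sub>m n n) (0\<^sub>m n n) B \<in> carrier_mat (n + n) (n + n)"
  by (rule four_block_carrier_mat)

lemma four_block_diag_mult:
  fixes A B C D :: "complex mat"
  assumes "A \<in> carrier_mat n n" "B \<in> carrier_mat n n" "C \<in> carrier_mat n n" "D \<in> carrier_mat n n"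
  shows "four_block_mat A (0\<^sub>m n n) (0\<^sub>m n n) B * four_block_mat C (0\<^sub>m n n) (0\<^sub>m n n) D
    = four_block_mat (A * C) (0\<^sub>m n n) (0\<^sub>m n n) (B * D)"
  using assms by (subst mult_four_block_mat[of _ n n _ n _ n _ _ n _ n]) simp_all

lemma four_block_diag_pow:
  fixes A B :: "complex mat"
  assumes "A \<in> carrier_mat n n" "B \<in> carrier_mat n n"
  shows "four_block_mat A (0\<^sub>m n n) (0\<^sub>m n n) B ^\<^sub>m k
    = four_block_mat (A ^\<^sub>m k) (0\<^sub>m n n) (0\<^sub>m n n) (B ^\<^sub>m k)"
proof (induction k)
  case 0
  show ?case using assms by (simp add: four_block_one_mat)
next
  case (Suc k)
  then show ?case using assms by (simp add: four_block_diag_mult pow_carrier_mat)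
qed

lemma sum_lessThan_add:
  fixes f :: "nat \<Rightarrow> complex"
  shows "(\<Sum>i<n + k. f i) = (\<Sum>i<n. f i) + (\<Sum>i<k. f (n + i))"
  by (induction k) (simp_all add: add.assoc)

lemma mat_trace_four_block_diag:
  assumes "A \<in> carrier_mat n n" "B \<in> carrier_mat n n"
  shows "mat_trace (four_block_mat A (0\<^sub>m n n) (0\<^sub>m n n) B) = mat_trace A + mat_trace B"
proof -
  let ?F = "four_block_mat A (0\<^sub>m n n) (0\<^sub>m n n) B"
  have "mat_trace ?F = (\<Sum>i<n + n. ?F $$ (i,i))"
    by (rule mat_trace_carrier[OF four_block_diag_carrier[OF assms]])
  also have "\<dots> = (\<Sum>i<n. ?F $$ (i,i)) + (\<Sum>i<n. ?F $$ (n + i, n + i))"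
    by (rule sum_lessThan_add)
  also have "\<dots> = mat_trace A + mat_trace B"
    using assms by (simp add: mat_trace_carrier[of A n n] mat_trace_carrier[of B n n])
  finally show ?thesis .
qed

context cyclic_extension
begin

text \<open>The module \<rho> \<oplus> \<rho> \<circ> \<beta>\<inverse> of \<open>N\<close> is
  extended to \<open>G\<close> by a block matrix \<open>M\<close> whose square is diagonal with both
  blocks a multiple of \<rho>(t). An invariant subspace is zero or contains a summand, and
  \<open>M\<close> carries each summand onto the other.\<close>

lemma extend_swapped_pair:
  assumes irr: "irreducible_representation N n \<rho>"
    and s0: "s0 \<in> carrier N" "mat_trace (\<rho> (\<beta> s0)) \<noteq> mat_trace (\<rho> s0)"
    and t: "t \<in> carrier N" and \<beta>2: "\<And>s. s \<in> carrier N \<Longrightarrow> \<beta> (\<beta> s) = t \<otimes>\<^bsub>N\<^esub> s \<otimes>\<^bsub>N\<^esub> inv\<^bsub>N\<^esub> t"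
  obtains a R where "irreducible_representation G a R"
    "\<And>s. s \<in> carrier N \<Longrightarrow> mat_trace (R (\<iota> s)) = mat_trace (\<rho> s) + mat_trace (\<rho> (inv_into (carrier N) \<beta> s))"
proof -
  have n: "n > 0" and \<rho>: "representation N n \<rho>"
    using irr unfolding irreducible_representation_def by auto
  note c [simp] = rep_carrier[OF group_N \<rho>] and mult = rep_mult[OF group_N \<rho>]
  note zero_one = left_mult_zero_mat[of _ n n] right_mult_zero_mat[of _ n n] left_add_zero_mat[of _ n n]
    right_add_zero_mat[of _ n n] left_mult_one_mat[of _ n n] right_mult_one_mat[of _ n n] mult_carrier_mat[of _ n n _ n]
  define \<beta>' where "\<beta>' = inv_into (carrier N) \<beta>"
  have \<beta>'_closed [simp]: "\<beta>' s \<in> carrier N" and \<beta>\<beta>' [simp]: "\<beta> (\<beta>' s) = s" if "s \<in> carrier N" for s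
    using that beta_bij bij_betw_inv_into[OF beta_bij] unfolding \<beta>'_def
    by (auto simp: bij_betw_def f_inv_into_f)
  have \<beta>'\<beta> [simp]: "\<beta>' (\<beta> s) = s" if "s \<in> carrier N" for s
    using that beta_bij unfolding \<beta>'_def by (simp add: bij_betw_def)
  have \<beta>'_mult: "\<beta>' (s \<otimes>\<^bsub>N\<^esub> s') = \<beta>' s \<otimes>\<^bsub>N\<^esub> \<beta>' s'" if "s \<in> carrier N" "s' \<in> carrier N" for s s'
  proof -
    have "\<beta> (\<beta>' s \<otimes>\<^bsub>N\<^esub> \<beta>' s') = s \<otimes>\<^bsub>N\<^esub> s'" using that by (simp add: beta_mult)
    then show ?thesis using that by (metis N.m_closed \<beta>'\<beta> \<beta>'_closed)
  qed
  have \<beta>'_one: "\<beta>' \<one>\<^bsub>N\<^esub> = \<one>\<^bsub>N\<^esub>" using \<beta>'\<beta>[OF N.one_closed] by (simp add: beta_one)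
  have \<beta>'_u: "\<beta>' u = u" using \<beta>'\<beta>[OF u_closed] by (simp add: beta_u)
  define \<rho>' where "\<rho>' = (\<lambda>s. \<rho> (\<beta>' s))"
  have \<rho>': "representation N n \<rho>'"
    unfolding representation_iff[OF group_N] \<rho>'_def
    by (simp add: \<beta>'_mult \<beta>'_one mult rep_one[OF group_N \<rho>])
  note c' [simp] = rep_carrier[OF group_N \<rho>']
  \<comment> \<open>\<beta>\<inverse> permutes \<open>N\<close>, so \<rho> and
    \<open>\<rho>'\<close> take the same values and have the same invariant subspaces.\<close>
  have irr': "irreducible_representation N n \<rho>'"
    unfolding irreducible_representation_def
  proof (intro conjI allI impI)
    fix W assume W: "VectorSpace.subspace class_ring W (module_vec TYPE(complex) n) \<and>
      (\<forall>x\<in>carrier N. \<forall>w\<in>W. \<rho>' x *\<^sub>v w \<in> W)"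
    then have "\<forall>s\<in>carrier N. \<forall>w\<in>W. \<rho> s *\<^sub>v w \<in> W" unfolding \<rho>'_def by (metis \<beta>'\<beta> beta_closed)
    then show "W = {0\<^sub>v n} \<or> W = carrier_vec n"
      using irr W unfolding irreducible_representation_def by blast
  qed (use n \<rho>' in auto)
  have sq_trace: "mat_trace (\<rho> ((\<beta> ^^ (2 * j)) s)) = mat_trace (\<rho> s)" if "s \<in> carrier N" for j s
  proof (induction j)
    case (Suc j)
    have "(\<beta> ^^ (2 * Suc j)) s = \<beta> (\<beta> ((\<beta> ^^ (2 * j)) s))" by simp
    also have "\<dots> = t \<otimes>\<^bsub>N\<^esub> (\<beta> ^^ (2 * j)) s \<otimes>\<^bsub>N\<^esub> inv\<^bsub>N\<^esub> t" using that by (intro \<beta>2) simp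
    finally show ?case using Suc that t by (simp only: rep_trace_conjugate[OF group_N \<rho>] beta_pow_closed)
  qed simp
  \<comment> \<open>Even powers of \<beta> preserve the character by \<open>sq_trace\<close>, and
    the m-th power does because it is conjugation by \<open>u\<close>. For odd \<open>m\<close> so
    would \<beta>, contradicting \<open>s0\<close>.\<close>
  have "even m"
  proof (rule ccontr)
    assume "odd m"
    then obtain j where j: "m = Suc (2 * j)" by (metis oddE Suc_eq_plus1)
    have "mat_trace (\<rho> (\<beta> s0)) = mat_trace (\<rho> ((\<beta> ^^ (2 * j)) (\<beta> s0)))"
      using s0(1) by (simp only: sq_trace beta_closed)
    also have "(\<beta> ^^ (2 * j)) (\<beta> s0) = (\<beta> ^^ m) s0" unfolding j by (simp only: funpow_swap1 funpow.simps comp_apply)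
    also have "(\<beta> ^^ m) s0 = u \<otimes>\<^bsub>N\<^esub> s0 \<otimes>\<^bsub>N\<^esub> inv\<^bsub>N\<^esub> u"
      using beta_pow_m[OF s0(1)] s0(1) u_closed by (metis N.inv_solve_right N.m_closed beta_pow_closed)
    also have "mat_trace (\<rho> \<dots>) = mat_trace (\<rho> s0)" by (rule rep_trace_conjugate[OF group_N \<rho> u_closed s0(1)])
    finally show False using s0(2) by simp
  qed
  then obtain j where j: "m = 2 * j" by (rule evenE)
  have j0: "j > 0" using m_pos j by simp
  have \<beta>2_pow: "((\<lambda>s. \<beta> (\<beta> s)) ^^ j) s = (\<beta> ^^ m) s" for s
    unfolding j by (induction j) auto
  have t_eq: "\<rho> t * \<rho> s = \<rho> (\<beta> (\<beta> s)) * \<rho> t" if "s \<in> carrier N" for s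
    using that t by (simp add: \<beta>2 mult[symmetric] N.m_assoc del: c)
  \<comment> \<open>Applied to \<beta> \<circ> \<beta> with exponent \<open>j\<close>, half of
    \<open>m\<close>: \<rho>(t) realises \<beta> \<circ> \<beta>, whose j-th power is conjugation by
    \<open>u\<close>.\<close>
  obtain z where z: "z \<noteq> 0" "(z \<cdot>\<^sub>m \<rho> t) ^\<^sub>m j = \<rho> u"
    by (rule exists_scaled_root[OF group_N irr c[OF t] c[OF N.inv_closed[OF t]] rep_inv(2)[OF group_N \<rho> t] _ t_eq j0 u_closed])
      (auto simp: \<beta>2_pow beta_pow_m)
  define Y where "Y = z \<cdot>\<^sub>m \<rho> t"
  have Y [simp]: "Y \<in> carrier_mat n n" using t by (simp add: Y_def)
  have Y_eq: "Y * \<rho> s = \<rho> (\<beta> (\<beta> s)) * Y" if "s \<in> carrier N" for s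
    using that t t_eq by (simp add: Y_def mult_smult_distrib[of _ n n _ n] mult_smult_assoc_mat[of _ n n _ n])
  have Yj: "Y ^\<^sub>m j = \<rho> u" using z by (simp add: Y_def)
  define Y' where "Y' = inverse z \<cdot>\<^sub>m \<rho> (inv\<^bsub>N\<^esub> t)"
  have Y' [simp]: "Y' \<in> carrier_mat n n" using t by (simp add: Y'_def)
  have YY': "Y * Y' = 1\<^sub>m n"
    using t z(1) rep_inv(1)[OF group_N \<rho> t] unfolding Y_def Y'_def
    by (simp add: mult_smult_distrib[of _ n n _ n] mult_smult_assoc_mat[of _ n n _ n]) (auto intro!: eq_matI)
  define D where "D = (\<lambda>s. four_block_mat (\<rho> s) (0\<^sub>m n n) (0\<^sub>m n n) (\<rho>' s))"
  \<comment> \<open>This is (v, w) \<mapsto> (Y w, v).\<close>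
  define M where "M = four_block_mat (0\<^sub>m n n) Y (1\<^sub>m n) (0\<^sub>m n n)"
  have D_rep: "representation N (n + n) D"
    unfolding representation_iff[OF group_N] D_def
    by (auto simp: four_block_diag_mult four_block_diag_carrier mult rep_mult[OF group_N \<rho>']
        rep_one[OF group_N \<rho>] rep_one[OF group_N \<rho>'] four_block_one_mat)
  have M: "M \<in> carrier_mat (n + n) (n + n)" unfolding M_def by (rule four_block_carrier_mat) auto
  have M_eq: "M * D s = D (\<beta> s) * M" if s: "s \<in> carrier N" for s
  proof -
    have "M * D s = four_block_mat (0\<^sub>m n n) (Y * \<rho>' s) (\<rho> s) (0\<^sub>m n n)"
      unfolding M_def D_def using s
      by (subst mult_four_block_mat[of _ n n _ n _ n _ _ n _ n]) (simp_all add: zero_one)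
    also have "Y * \<rho>' s = \<rho> (\<beta> s) * Y" using s Y_eq[of "\<beta>' s"] by (simp add: \<rho>'_def)
    also have "four_block_mat (0\<^sub>m n n) (\<rho> (\<beta> s) * Y) (\<rho> s) (0\<^sub>m n n) = D (\<beta> s) * M"
      unfolding M_def D_def using s
      by (subst mult_four_block_mat[of _ n n _ n _ n _ _ n _ n]) (simp_all add: \<rho>'_def zero_one)
    finally show ?thesis .
  qed
  have "M ^\<^sub>m m = (M ^\<^sub>m 2) ^\<^sub>m j" unfolding j by (rule pow_mat_mult[OF M])
  also have "M ^\<^sub>m 2 = M * M" using M by (simp add: numeral_2_eq_2)
  also have "M * M = four_block_mat Y (0\<^sub>m n n) (0\<^sub>m n n) Y"
    unfolding M_def by (subst mult_four_block_mat[of _ n n _ n _ n _ _ n _ n]) (simp_all add: zero_one)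
  \<comment> \<open>The two blocks of \<open>D u\<close> coincide because \<beta> fixes
    \<open>u\<close>.\<close>
  also have "\<dots> ^\<^sub>m j = D u" by (simp add: four_block_diag_pow Yj D_def \<rho>'_def \<beta>'_u)
  finally have Mm: "M ^\<^sub>m m = D u" .
  obtain R where R: "representation G (n + n) R" and R_iota: "\<And>s. s \<in> carrier N \<Longrightarrow> R (\<iota> s) = D s" and R_g: "R g = M"
    by (rule extend_representation[OF D_rep M M_eq Mm]) auto
  have "irreducible_representation G (n + n) R"
    unfolding irreducible_representation_def
  proof (intro conjI allI impI)
    fix W assume W: "VectorSpace.subspace class_ring W (module_vec TYPE(complex) (n + n)) \<and>
      (\<forall>x\<in>carrier G. \<forall>w\<in>W. R x *\<^sub>v w \<in> W)"
    then have W_sub: "W \<subseteq> carrier_vec (n + n)" "0\<^sub>v (n + n) \<in> W"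
      and add: "\<And>v w. v \<in> W \<Longrightarrow> w \<in> W \<Longrightarrow> v + w \<in> W" and smult: "\<And>c v. v \<in> W \<Longrightarrow> c \<cdot>\<^sub>v v \<in> W"
      and inv: "\<And>x w. x \<in> carrier G \<Longrightarrow> w \<in> W \<Longrightarrow> R x *\<^sub>v w \<in> W"
      unfolding vec_subspace_iff by auto
    have inv_D: "(\<rho> s *\<^sub>v v) @\<^sub>v (\<rho>' s *\<^sub>v w) \<in> W"
      if "s \<in> carrier N" "v \<in> carrier_vec n" "w \<in> carrier_vec n" "v @\<^sub>v w \<in> W" for s v w
      using inv[OF iota_closed[OF that(1)] that(4)] that
      by (simp add: R_iota D_def mult_mat_vec_split[of _ n _ n])
    have inv_M: "(Y *\<^sub>v w) @\<^sub>v v \<in> W" if "v \<in> carrier_vec n" "w \<in> carrier_vec n" "v @\<^sub>v w \<in> W" for v w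
      using inv[OF g_closed that(3)] that mult_mat_vec_carrier[OF Y that(2)] unfolding R_g M_def
      by (simp add: four_block_mat_mult_vec[of _ n n _ n _ n] zero_mat_mult_vec)
    have full: "v @\<^sub>v w \<in> W"
      if "v \<in> carrier_vec n" "w \<in> carrier_vec n" "v @\<^sub>v 0\<^sub>v n \<in> W" "0\<^sub>v n @\<^sub>v w \<in> W" for v w
      using add[OF that(3,4)] append_vec_add[OF that(1) zero_carrier_vec zero_carrier_vec that(2)] that(1,2) by simp
    \<comment> \<open>At \<open>\<beta> s0\<close> the value of \<open>\<rho>'\<close> is
      \<open>\<rho> s0\<close>, so \<open>s0\<close> separates the two characters.\<close>
    have ne: "mat_trace (\<rho> (\<beta> s0)) \<noteq> mat_trace (\<rho>' (\<beta> s0))" using s0 by (simp add: \<rho>'_def)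
    consider "W = {0\<^sub>v (n + n)}" | "\<forall>v\<in>carrier_vec n. v @\<^sub>v 0\<^sub>v n \<in> W" | "\<forall>v\<in>carrier_vec n. 0\<^sub>v n @\<^sub>v v \<in> W"
      using invariant_subspace_direct_sum[OF group_N irr irr' beta_closed[OF s0(1)] ne W_sub add smult inv_D] by blast
    then show "W = {0\<^sub>v (n + n)} \<or> W = carrier_vec (n + n)"
    proof cases
      case 1
      then show ?thesis by simp
    next
      case 2
      have right: "0\<^sub>v n @\<^sub>v v \<in> W" if v: "v \<in> carrier_vec n" for v
      proof -
        \<comment> \<open>\<open>M\<close> sends (v, 0) to (0, v).\<close>
        have "Y *\<^sub>v 0\<^sub>v n = 0\<^sub>v n" by (intro eq_vecI) (simp_all add: carrier_matD[OF Y])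
        with inv_M[OF v zero_carrier_vec] 2 v show ?thesis by simp
      qed
      have "x \<in> W" if "x \<in> carrier_vec (n + n)" for x
        using that by (rule carrier_append_vecE) (use 2 right full in blast)
      with W_sub(1) show ?thesis by blast
    next
      case 3
      have left: "v @\<^sub>v 0\<^sub>v n \<in> W" if v: "v \<in> carrier_vec n" for v
      proof -
        have Y'v: "Y' *\<^sub>v v \<in> carrier_vec n" using Y' v by (rule mult_mat_vec_carrier)
        \<comment> \<open>\<open>M\<close> sends (0, Y' v) to (v, 0), since \<open>Y'\<close>
          inverts \<open>Y\<close>.\<close>
        have "Y *\<^sub>v (Y' *\<^sub>v v) = v" using YY' v assoc_mult_mat_vec[OF Y Y' v] by simp
        with inv_M[OF zero_carrier_vec Y'v] 3 Y'v show ?thesis by simp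
      qed
      have "x \<in> W" if "x \<in> carrier_vec (n + n)" for x
        using that by (rule carrier_append_vecE) (use 3 left full in blast)
      with W_sub(1) show ?thesis by blast
    qed
  qed (use n R in auto)
  moreover have "mat_trace (R (\<iota> s)) = mat_trace (\<rho> s) + mat_trace (\<rho> (inv_into (carrier N) \<beta> s))"
    if "s \<in> carrier N" for s
    using that by (simp add: R_iota D_def mat_trace_four_block_diag) (simp add: \<rho>'_def \<beta>'_def)
  ultimately show ?thesis by (rule that)
qed

end

section \<open>Character criteria for the two types\<close>

lemma IrrE:
  assumes "\<chi> \<in> Irr G"
  obtains n \<rho> where "irreducible_representation G n \<rho>" "\<chi> = (\<lambda>g\<in>carrier G. mat_trace (\<rho> g))"
  using assms unfolding Irr_def by blast

lemma IrrI: "irreducible_representation G n \<rho> \<Longrightarrow> (\<lambda>g\<in>carrier G. mat_trace (\<rho> g)) \<in> Irr G"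
  unfolding Irr_def by blast

context cyclic_extension
begin

text \<open>Replaces the inverse of \<beta> in the twist by \<beta> itself, which is legitimate
  because \<beta> permutes \<open>N\<close>; extensionality upgrades agreement on \<open>N\<close>
  to equality of functions.\<close>

lemma twist_eq_iff:
  assumes "\<theta> \<in> extensional (carrier N)"
  shows "twist N \<theta> \<beta> = \<theta> \<longleftrightarrow> (\<forall>s\<in>carrier N. \<theta> (\<beta> s) = \<theta> s)"
proof
  assume eq: "twist N \<theta> \<beta> = \<theta>"
  show "\<forall>s\<in>carrier N. \<theta> (\<beta> s) = \<theta> s"
  proof
    fix s assume s: "s \<in> carrier N"
    have "\<theta> (\<beta> s) = twist N \<theta> \<beta> (\<beta> s)" by (simp add: eq)
    also have "\<dots> = \<theta> s" using s beta_bij by (simp add: twist_def bij_betw_def)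
    finally show "\<theta> (\<beta> s) = \<theta> s" .
  qed
next
  assume inv: "\<forall>s\<in>carrier N. \<theta> (\<beta> s) = \<theta> s"
  show "twist N \<theta> \<beta> = \<theta>"
  proof (rule extensionalityI[OF _ assms])
    show "twist N \<theta> \<beta> \<in> extensional (carrier N)" by (simp add: twist_def)
    fix s assume s: "s \<in> carrier N"
    then have "inv_into (carrier N) \<beta> s \<in> carrier N" "\<beta> (inv_into (carrier N) \<beta> s) = s"
      using beta_bij by (auto simp: bij_betw_def inv_into_into f_inv_into_f)
    with inv s show "twist N \<theta> \<beta> s = \<theta> s" by (metis restrict_apply' twist_def)
  qed
qed

lemma type_1_iff_extends:
  assumes "\<theta> \<in> Irr N"
  shows "type_1 N \<beta> \<theta> \<longleftrightarrow> (\<exists>\<psi>\<in>Irr G. (\<lambda>s\<in>carrier N. \<psi> (\<iota> s)) = \<theta>)"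
proof -
  from assms obtain n \<rho> where irr: "irreducible_representation N n \<rho>"
    and \<theta>: "\<theta> = (\<lambda>s\<in>carrier N. mat_trace (\<rho> s))" by (rule IrrE)
  have twist: "type_1 N \<beta> \<theta> \<longleftrightarrow> (\<forall>s\<in>carrier N. \<theta> (\<beta> s) = \<theta> s)"
    unfolding type_1_def by (rule twist_eq_iff) (simp add: \<theta>)
  show ?thesis unfolding twist
  proof
    assume "\<forall>s\<in>carrier N. \<theta> (\<beta> s) = \<theta> s"
    then have "\<And>s. s \<in> carrier N \<Longrightarrow> mat_trace (\<rho> (\<beta> s)) = mat_trace (\<rho> s)" by (simp add: \<theta>)
    with irr obtain R where R: "irreducible_representation G n R" "\<And>s. s \<in> carrier N \<Longrightarrow> R (\<iota> s) = \<rho> s"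
      by (rule extend_invariant_representation) auto
    show "\<exists>\<psi>\<in>Irr G. (\<lambda>s\<in>carrier N. \<psi> (\<iota> s)) = \<theta>"
      by (rule bexI[OF _ IrrI[OF R(1)]]) (auto simp: \<theta> R(2) intro!: restrict_ext)
  next
    assume "\<exists>\<psi>\<in>Irr G. (\<lambda>s\<in>carrier N. \<psi> (\<iota> s)) = \<theta>"
    then obtain \<psi> where \<psi>: "\<psi> \<in> Irr G" "(\<lambda>s\<in>carrier N. \<psi> (\<iota> s)) = \<theta>" by blast
    from \<psi>(1) obtain a R where R: "irreducible_representation G a R"
      and \<psi>_eq: "\<psi> = (\<lambda>x\<in>carrier G. mat_trace (R x))" by (rule IrrE)
    have rep: "representation G a R" using R unfolding irreducible_representation_def by simp
    show "\<forall>s\<in>carrier N. \<theta> (\<beta> s) = \<theta> s"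
    proof
      fix s assume s: "s \<in> carrier N"
      \<comment> \<open>\<beta> is conjugation by \<open>g\<close> inside \<open>G\<close>, and
        characters of \<open>G\<close> are class functions.\<close>
      have "\<iota> (\<beta> s) = g \<otimes>\<^bsub>G\<^esub> \<iota> s \<otimes>\<^bsub>G\<^esub> inv\<^bsub>G\<^esub> g"
        using s g_closed by (simp add: conj_g G.m_assoc)
      then have "mat_trace (R (\<iota> (\<beta> s))) = mat_trace (R (\<iota> s))"
        using rep_trace_conjugate[OF group_G rep g_closed iota_closed[OF s]] by simp
      then show "\<theta> (\<beta> s) = \<theta> s" using s by (simp add: \<psi>(2)[symmetric] \<psi>_eq)
    qed
  qed
qed

text \<open>The locale makes only the m-th power of \<beta> inner. That already \<beta> \<circ>
  \<beta> is inner, by \<open>t\<close>, is what limits the orbit of \<theta> to two characters. For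
  invariant \<theta> the right-hand sum is 2\<theta>, which is not a restriction of an irreducible
  character.\<close>

lemma type_2_iff_extends:
  assumes "\<theta> \<in> Irr N"
    and t: "t \<in> carrier N" and \<beta>2: "\<And>s. s \<in> carrier N \<Longrightarrow> \<beta> (\<beta> s) = t \<otimes>\<^bsub>N\<^esub> s \<otimes>\<^bsub>N\<^esub> inv\<^bsub>N\<^esub> t"
  shows "type_2 N \<beta> \<theta> \<longleftrightarrow>
    (\<exists>\<psi>\<in>Irr G. (\<lambda>s\<in>carrier N. \<psi> (\<iota> s)) = char_add N \<theta> (twist N \<theta> \<beta>))"
proof -
  from assms(1) obtain n \<rho> where irr: "irreducible_representation N n \<rho>"
    and \<theta>: "\<theta> = (\<lambda>s\<in>carrier N. mat_trace (\<rho> s))" by (rule IrrE)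
  have twist: "twist N \<theta> \<beta> = \<theta> \<longleftrightarrow> (\<forall>s\<in>carrier N. \<theta> (\<beta> s) = \<theta> s)"
    by (rule twist_eq_iff) (simp add: \<theta>)
  show ?thesis unfolding type_2_def
  proof
    assume "twist N \<theta> \<beta> \<noteq> \<theta>"
    then obtain s0 where s0: "s0 \<in> carrier N" "mat_trace (\<rho> (\<beta> s0)) \<noteq> mat_trace (\<rho> s0)"
      unfolding twist by (auto simp: \<theta>)
    obtain a R where R: "irreducible_representation G a R"
      "\<And>s. s \<in> carrier N \<Longrightarrow> mat_trace (R (\<iota> s)) = mat_trace (\<rho> s) + mat_trace (\<rho> (inv_into (carrier N) \<beta> s))"
      by (rule extend_swapped_pair[OF irr s0 t \<beta>2]) auto
    have inv: "inv_into (carrier N) \<beta> s \<in> carrier N" if "s \<in> carrier N" for s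
      using that beta_bij by (simp add: bij_betw_def inv_into_into)
    have "(\<lambda>s\<in>carrier N. (\<lambda>x\<in>carrier G. mat_trace (R x)) (\<iota> s)) = char_add N \<theta> (twist N \<theta> \<beta>)"
      unfolding char_add_def by (rule restrict_ext) (simp add: R(2) \<theta> twist_def inv)
    then show "\<exists>\<psi>\<in>Irr G. (\<lambda>s\<in>carrier N. \<psi> (\<iota> s)) = char_add N \<theta> (twist N \<theta> \<beta>)"
      by (rule bexI[OF _ IrrI[OF R(1)]])
  next
    assume "\<exists>\<psi>\<in>Irr G. (\<lambda>s\<in>carrier N. \<psi> (\<iota> s)) = char_add N \<theta> (twist N \<theta> \<beta>)"
    then obtain \<psi> where \<psi>: "\<psi> \<in> Irr G" "(\<lambda>s\<in>carrier N. \<psi> (\<iota> s)) = char_add N \<theta> (twist N \<theta> \<beta>)" by blast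
    from \<psi>(1) obtain a R where R: "irreducible_representation G a R"
      and \<psi>_eq: "\<psi> = (\<lambda>x\<in>carrier G. mat_trace (R x))" by (rule IrrE)
    show "twist N \<theta> \<beta> \<noteq> \<theta>"
    proof
      assume eq: "twist N \<theta> \<beta> = \<theta>"
      then have inv: "\<And>s. s \<in> carrier N \<Longrightarrow> mat_trace (\<rho> (\<beta> s)) = mat_trace (\<rho> s)"
        unfolding twist by (simp add: \<theta>)
      have "mat_trace (R (\<iota> s)) = 2 * mat_trace (\<rho> s)" if s: "s \<in> carrier N" for s
        using fun_cong[OF \<psi>(2), of s] s unfolding eq by (simp add: \<psi>_eq char_add_def \<theta>)
      from irreducible_restriction_not_twice[OF irr inv R this] show False by simp
    qed
  qed
qed

end

section \<open>The semidirect product and extensions of index two\<close>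

lemma AutoGroup_mult:
  "\<phi> \<in> auto N \<Longrightarrow> \<psi> \<in> auto N \<Longrightarrow> \<phi> \<otimes>\<^bsub>AutoGroup N\<^esub> \<psi> = compose (carrier N) \<phi> \<psi>"
  by (simp add: AutoGroup_def BijGroup_def auto_def)

lemma AutoGroup_one: "\<one>\<^bsub>AutoGroup N\<^esub> = (\<lambda>x\<in>carrier N. x)"
  by (simp add: AutoGroup_def BijGroup_def)

lemma AutoGroup_carrier [simp]: "carrier (AutoGroup N) = auto N"
  by (simp add: AutoGroup_def)

text \<open>Automorphisms are extensional, so they lie in a finite function space. This makes the
  order of \<alpha> positive.\<close>

lemma finite_auto:
  assumes "finite (carrier N)"
  shows "finite (auto N)"
proof (rule finite_subset)
  show "auto N \<subseteq> carrier N \<rightarrow>\<^sub>E carrier N"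
    by (auto simp: auto_def Bij_def hom_def PiE_def)
qed (use assms in \<open>simp add: finite_PiE\<close>)

lemma semidirect_cyclic_group:
  assumes N: "group N" and \<alpha>: "\<alpha> \<in> auto N"
  shows "group (semidirect_cyclic N \<alpha>)"
proof -
  interpret N: group N by fact
  interpret A: group "AutoGroup N" by (rule N.AutoGroup)
  let ?K = "generate (AutoGroup N) {\<alpha>}"
  have K: "subgroup ?K (AutoGroup N)" using \<alpha> by (intro A.generate_is_subgroup) simp
  have K_auto: "\<phi> \<in> auto N" if "\<phi> \<in> ?K" for \<phi> using subgroup.mem_carrier[OF K that] by simp
  have app [simp]: "\<phi> x \<in> carrier N" if "\<phi> \<in> ?K" "x \<in> carrier N" for \<phi> x
    using K_auto[OF that(1)] that(2) by (auto simp: auto_def hom_def)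
  have app_mult: "\<phi> (x \<otimes>\<^bsub>N\<^esub> y) = \<phi> x \<otimes>\<^bsub>N\<^esub> \<phi> y" if "\<phi> \<in> ?K" "x \<in> carrier N" "y \<in> carrier N" for \<phi> x y
    using K_auto[OF that(1)] that(2,3) by (auto simp: auto_def hom_def)
  have app_comp: "(\<phi> \<otimes>\<^bsub>AutoGroup N\<^esub> \<psi>) x = \<phi> (\<psi> x)" if "\<phi> \<in> ?K" "\<psi> \<in> ?K" "x \<in> carrier N" for \<phi> \<psi> x
    using K_auto that by (simp add: AutoGroup_mult compose_eq)
  have app_one: "\<phi> \<one>\<^bsub>N\<^esub> = \<one>\<^bsub>N\<^esub>" if "\<phi> \<in> ?K" for \<phi>
    using K_auto[OF that] hom_one[OF _ N N] by (simp add: auto_def)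
  note Kc = subgroup.m_closed[OF K] subgroup.one_closed[OF K] subgroup.m_inv_closed[OF K]
  show ?thesis
  proof (rule groupI)
    fix x y assume "x \<in> carrier (semidirect_cyclic N \<alpha>)" "y \<in> carrier (semidirect_cyclic N \<alpha>)"
    then show "x \<otimes>\<^bsub>semidirect_cyclic N \<alpha>\<^esub> y \<in> carrier (semidirect_cyclic N \<alpha>)"
      by (auto simp: semidirect_cyclic_def Kc)
  next
    show "\<one>\<^bsub>semidirect_cyclic N \<alpha>\<^esub> \<in> carrier (semidirect_cyclic N \<alpha>)"
      by (simp add: semidirect_cyclic_def Kc)
  next
    fix x y z assume "x \<in> carrier (semidirect_cyclic N \<alpha>)" "y \<in> carrier (semidirect_cyclic N \<alpha>)"
      "z \<in> carrier (semidirect_cyclic N \<alpha>)"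
    then show "x \<otimes>\<^bsub>semidirect_cyclic N \<alpha>\<^esub> y \<otimes>\<^bsub>semidirect_cyclic N \<alpha>\<^esub> z
      = x \<otimes>\<^bsub>semidirect_cyclic N \<alpha>\<^esub> (y \<otimes>\<^bsub>semidirect_cyclic N \<alpha>\<^esub> z)"
      by (auto simp: semidirect_cyclic_def app_mult app_comp N.m_assoc A.m_assoc K_auto)
  next
    fix x assume "x \<in> carrier (semidirect_cyclic N \<alpha>)"
    then show "\<one>\<^bsub>semidirect_cyclic N \<alpha>\<^esub> \<otimes>\<^bsub>semidirect_cyclic N \<alpha>\<^esub> x = x"
      by (auto simp: semidirect_cyclic_def K_auto) (simp add: AutoGroup_one)
  next
    fix x assume "x \<in> carrier (semidirect_cyclic N \<alpha>)"
    then obtain s \<phi> where x: "x = (s, \<phi>)" "s \<in> carrier N" "\<phi> \<in> ?K" by (auto simp: semidirect_cyclic_def)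
    let ?\<phi>' = "inv\<^bsub>AutoGroup N\<^esub> \<phi>"
    \<comment> \<open>The left inverse of (s, \<phi>) is (\<phi>\<inverse>(s\<inverse>),
      \<phi>\<inverse>).\<close>
    have "?\<phi>' (inv\<^bsub>N\<^esub> s) \<otimes>\<^bsub>N\<^esub> ?\<phi>' s = \<one>\<^bsub>N\<^esub>"
      using x by (simp add: app_mult[symmetric] Kc app_one)
    then show "\<exists>y\<in>carrier (semidirect_cyclic N \<alpha>). y \<otimes>\<^bsub>semidirect_cyclic N \<alpha>\<^esub> x = \<one>\<^bsub>semidirect_cyclic N \<alpha>\<^esub>"
      using x by (intro bexI[of _ "(?\<phi>' (inv\<^bsub>N\<^esub> s), ?\<phi>')"]) (auto simp: semidirect_cyclic_def Kc K_auto)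
  qed
qed

text \<open>The k-th power of (1, \<alpha>) is (1, \<alpha>^k), which lies in the copy of
  \<open>N\<close> exactly when \<alpha>^k is the identity. Hence \<open>m\<close> is the order of
  \<alpha> and \<open>u\<close> is 1.\<close>

lemma semidirect_cyclic_extension:
  assumes N: "group N" "finite (carrier N)" and \<alpha>: "\<alpha> \<in> auto N"
  shows "cyclic_extension N (semidirect_cyclic N \<alpha>) (\<lambda>s. (s, \<one>\<^bsub>AutoGroup N\<^esub>)) (\<one>\<^bsub>N\<^esub>, \<alpha>) \<alpha>
    (group.ord (AutoGroup N) \<alpha>) \<one>\<^bsub>N\<^esub>"
proof -
  interpret N: group N by fact
  interpret A: group "AutoGroup N" by (rule N.AutoGroup)
  let ?A = "semidirect_cyclic N \<alpha>"
  interpret S: group ?A by (rule semidirect_cyclic_group[OF N(1) \<alpha>])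
  have fin: "finite (carrier (AutoGroup N))" using finite_auto[OF N(2)] by simp
  have \<alpha>': "\<alpha> \<in> carrier (AutoGroup N)" using \<alpha> by simp
  \<comment> \<open>In a finite group natural powers exhaust the generated subgroup, which supplies
    the natural exponents of \<open>decompose\<close>.\<close>
  have K: "generate (AutoGroup N) {\<alpha>} = {\<alpha> [^]\<^bsub>AutoGroup N\<^esub> k | k. k \<in> (UNIV :: nat set)}"
    by (rule A.generate_pow_on_finite_carrier[OF fin \<alpha>'])
  have pow_auto [simp]: "\<alpha> [^]\<^bsub>AutoGroup N\<^esub> (k::nat) \<in> auto N" for k using A.nat_pow_closed[OF \<alpha>'] by simp
  have \<alpha>_one: "\<alpha> \<one>\<^bsub>N\<^esub> = \<one>\<^bsub>N\<^esub>" using \<alpha> hom_one[OF _ N(1) N(1)] by (simp add: auto_def)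
  have pow_one: "(\<alpha> [^]\<^bsub>AutoGroup N\<^esub> (k::nat)) \<one>\<^bsub>N\<^esub> = \<one>\<^bsub>N\<^esub>" for k
    using pow_auto[of k] hom_one[OF _ N(1) N(1)] by (simp add: auto_def del: pow_auto)
  have \<alpha>_closed: "\<alpha> s \<in> carrier N" if "s \<in> carrier N" for s using \<alpha> that by (auto simp: auto_def hom_def)
  have g_pow: "(\<one>\<^bsub>N\<^esub>, \<alpha>) [^]\<^bsub>?A\<^esub> k = (\<one>\<^bsub>N\<^esub>, \<alpha> [^]\<^bsub>AutoGroup N\<^esub> k)" for k :: nat
  proof (induction k)
    case 0
    show ?case by (simp add: semidirect_cyclic_def)
  next
    case (Suc k)
    then show ?case by (simp add: semidirect_cyclic_def pow_one)
  qed
  have mult: "x \<otimes>\<^bsub>?A\<^esub> y = (fst x \<otimes>\<^bsub>N\<^esub> snd x (fst y), snd x \<otimes>\<^bsub>AutoGroup N\<^esub> snd y)" for x y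
    by (simp add: semidirect_cyclic_def split: prod.split)
  have one_auto [simp]: "\<one>\<^bsub>AutoGroup N\<^esub> \<in> auto N" using A.one_closed by simp
  have one_app: "\<one>\<^bsub>AutoGroup N\<^esub> s = s" if "s \<in> carrier N" for s using that by (simp add: AutoGroup_one)
  show ?thesis
  proof (unfold_locales)
    show "finite (carrier N)" by fact
    show "(\<lambda>s. (s, \<one>\<^bsub>AutoGroup N\<^esub>)) \<in> hom N ?A"
      by (auto simp: hom_def mult one_app) (simp_all add: semidirect_cyclic_def generate.one)
    show "inj_on (\<lambda>s. (s, \<one>\<^bsub>AutoGroup N\<^esub>)) (carrier N)" by (simp add: inj_on_def)
    show "(\<one>\<^bsub>N\<^esub>, \<alpha>) \<in> carrier ?A" by (simp add: semidirect_cyclic_def generate.incl)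
    show "\<alpha> \<in> auto N" by fact
    show "(\<one>\<^bsub>N\<^esub>, \<alpha>) \<otimes>\<^bsub>?A\<^esub> (s, \<one>\<^bsub>AutoGroup N\<^esub>) = (\<alpha> s, \<one>\<^bsub>AutoGroup N\<^esub>) \<otimes>\<^bsub>?A\<^esub> (\<one>\<^bsub>N\<^esub>, \<alpha>)"
      if "s \<in> carrier N" for s
      using \<alpha>' that \<alpha>_closed[OF that] by (simp add: mult one_app)
    show "A.ord \<alpha> > 0" using A.ord_ge_1[OF fin \<alpha>'] by simp
    show "\<one>\<^bsub>N\<^esub> \<in> carrier N" by simp
    show "(\<one>\<^bsub>N\<^esub>, \<alpha>) [^]\<^bsub>?A\<^esub> A.ord \<alpha> = (\<one>\<^bsub>N\<^esub>, \<one>\<^bsub>AutoGroup N\<^esub>)"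
      using \<alpha>' by (simp add: g_pow A.pow_ord_eq_1)
    show "A.ord \<alpha> dvd k" if "(\<one>\<^bsub>N\<^esub>, \<alpha>) [^]\<^bsub>?A\<^esub> k \<in> (\<lambda>s. (s, \<one>\<^bsub>AutoGroup N\<^esub>)) ` carrier N" for k :: nat
      using that A.pow_eq_id[OF \<alpha>', of k] by (auto simp: g_pow)
    show "\<exists>s\<in>carrier N. \<exists>k::nat. x = (s, \<one>\<^bsub>AutoGroup N\<^esub>) \<otimes>\<^bsub>?A\<^esub> (\<one>\<^bsub>N\<^esub>, \<alpha>) [^]\<^bsub>?A\<^esub> k"
      if "x \<in> carrier ?A" for x
    proof -
      from that obtain s k where x: "s \<in> carrier N" "x = (s, \<alpha> [^]\<^bsub>AutoGroup N\<^esub> (k::nat))"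
        unfolding semidirect_cyclic_def K by auto
      then have "x = (s, \<one>\<^bsub>AutoGroup N\<^esub>) \<otimes>\<^bsub>?A\<^esub> (\<one>\<^bsub>N\<^esub>, \<alpha>) [^]\<^bsub>?A\<^esub> k"
        using A.nat_pow_closed[OF \<alpha>', of k] by (simp add: mult g_pow one_app)
      with x show ?thesis by blast
    qed
  qed
qed

section \<open>Overgroups of index two\<close>

lemma index_two_mult_inv_mem:
  assumes H: "group H" "subgroup N H" and card: "card (rcosets\<^bsub>H\<^esub> N) = 2"
    and a: "a \<in> carrier H - N" and b: "b \<in> carrier H - N"
  shows "a \<otimes>\<^bsub>H\<^esub> inv\<^bsub>H\<^esub> b \<in> N"
proof -
  interpret group H by fact
  interpret subgroup N H by fact
  have sub: "N \<subseteq> carrier H" by (rule subset)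
  have self: "c \<in> N #>\<^bsub>H\<^esub> c" if "c \<in> carrier H" for c using rcos_self[OF that H(2)] .
  have one: "N #>\<^bsub>H\<^esub> \<one>\<^bsub>H\<^esub> = N" using coset_mult_one[OF sub] .
  have "{N #>\<^bsub>H\<^esub> \<one>\<^bsub>H\<^esub>, N #>\<^bsub>H\<^esub> a, N #>\<^bsub>H\<^esub> b} \<subseteq> rcosets\<^bsub>H\<^esub> N"
    using rcosetsI[OF sub monoid.one_closed[OF monoid_axioms]] rcosetsI[OF sub, of a] rcosetsI[OF sub, of b] a b by simp
  moreover have "finite (rcosets\<^bsub>H\<^esub> N)" using card by (intro card_ge_0_finite) simp
  \<comment> \<open>With only two cosets available and those of \<open>a\<close> and
    \<open>b\<close> both different from \<open>N\<close>, these two must coincide.\<close>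
  ultimately have "card {N, N #>\<^bsub>H\<^esub> a, N #>\<^bsub>H\<^esub> b} \<le> 2" using card card_mono by (metis one)
  moreover have "N #>\<^bsub>H\<^esub> a \<noteq> N" "N #>\<^bsub>H\<^esub> b \<noteq> N" using self a b by blast+
  ultimately have "N #>\<^bsub>H\<^esub> a = N #>\<^bsub>H\<^esub> b" by (auto simp: card_insert_if split: if_splits)
  then have "a \<in> N #>\<^bsub>H\<^esub> b" using self a by blast
  then obtain s where "s \<in> N" "a = s \<otimes>\<^bsub>H\<^esub> b" by (auto simp: r_coset_def)
  then show ?thesis using b by (simp add: m_assoc)
qed

lemma conj_by_Bij:
  assumes "N \<lhd> H" and h: "h \<in> carrier H"
  shows "conj_by H N h \<in> Bij N"
proof -
  interpret normal N H by fact
  have inv: "inv\<^bsub>H\<^esub> h \<in> carrier H" using h by simp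
  have cancel: "inv\<^bsub>H\<^esub> h \<otimes>\<^bsub>H\<^esub> (h \<otimes>\<^bsub>H\<^esub> a) = a" "h \<otimes>\<^bsub>H\<^esub> (inv\<^bsub>H\<^esub> h \<otimes>\<^bsub>H\<^esub> a) = a"
    if "a \<in> N" for a
    using that h inv by (simp_all add: m_assoc[symmetric])
  have "bij_betw (\<lambda>x. h \<otimes>\<^bsub>H\<^esub> x \<otimes>\<^bsub>H\<^esub> inv\<^bsub>H\<^esub> h) N N"
  proof (rule bij_betw_byWitness[where f' = "\<lambda>x. inv\<^bsub>H\<^esub> h \<otimes>\<^bsub>H\<^esub> x \<otimes>\<^bsub>H\<^esub> h"])
    show "(\<lambda>x. h \<otimes>\<^bsub>H\<^esub> x \<otimes>\<^bsub>H\<^esub> inv\<^bsub>H\<^esub> h) ` N \<subseteq> N" using h inv_op_closed2 by blast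
    show "(\<lambda>x. inv\<^bsub>H\<^esub> h \<otimes>\<^bsub>H\<^esub> x \<otimes>\<^bsub>H\<^esub> h) ` N \<subseteq> N" using h inv_op_closed1 by blast
  qed (use h cancel in \<open>auto simp: m_assoc\<close>)
  then show ?thesis
    by (auto simp: Bij_def conj_by_def cong: bij_betw_cong)
qed

lemma index_two_cyclic_extension:
  assumes H: "group H" "finite (carrier H)" and normal: "N \<lhd> H"
    and card: "card (rcosets\<^bsub>H\<^esub> N) = 2"
    and g: "g \<in> carrier H - N"
    and \<alpha>: "\<alpha> \<in> auto (H\<lparr>carrier := N\<rparr>)" and conj: "\<And>s. s \<in> N \<Longrightarrow> g \<otimes>\<^bsub>H\<^esub> s = \<alpha> s \<otimes>\<^bsub>H\<^esub> g"
  shows "cyclic_extension (H\<lparr>carrier := N\<rparr>) H (\<lambda>s. s) g \<alpha> 2 (g \<otimes>\<^bsub>H\<^esub> g)"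
proof -
  interpret normal N H by fact
  have sub: "subgroup N H" by (rule subgroup_axioms)
  note quotient = index_two_mult_inv_mem[OF H(1) sub card]
  have gc [simp]: "g \<in> carrier H" and gN: "g \<notin> N" using g by auto
  have "inv\<^bsub>H\<^esub> g \<notin> N" using gN m_inv_closed by (metis gc inv_inv)
  \<comment> \<open>The quotient of \<open>g\<close> by its inverse is the square of
    \<open>g\<close>.\<close>
  then have gg: "g \<otimes>\<^bsub>H\<^esub> g \<in> N" using quotient[of g "inv\<^bsub>H\<^esub> g"] g by simp
  have even_pow: "g [^]\<^bsub>H\<^esub> (2 * q) \<in> N" for q :: nat
  proof (induction q)
    case (Suc q)
    have "g [^]\<^bsub>H\<^esub> (2 * Suc q) = g [^]\<^bsub>H\<^esub> (2 * q) \<otimes>\<^bsub>H\<^esub> (g \<otimes>\<^bsub>H\<^esub> g)"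
      by (simp add: m_assoc)
    with Suc gg show ?case by simp
  qed simp
  show ?thesis
  proof (rule cyclic_extension.intro)
    show "group (H\<lparr>carrier := N\<rparr>)" using sub by (rule subgroup_imp_group)
    show "finite (carrier (H\<lparr>carrier := N\<rparr>))" using H(2) subset by (auto intro: finite_subset)
    show "(\<lambda>s. s) \<in> hom (H\<lparr>carrier := N\<rparr>) H" by (auto simp: hom_def)
    show "g [^]\<^bsub>H\<^esub> (2::nat) = g \<otimes>\<^bsub>H\<^esub> g" by (simp add: numeral_2_eq_2)
    show "2 dvd k" if k: "g [^]\<^bsub>H\<^esub> k \<in> (\<lambda>s. s) ` carrier (H\<lparr>carrier := N\<rparr>)" for k :: nat
    proof (rule ccontr)
      assume "\<not> 2 dvd k"
      then obtain q where q: "k = Suc (2 * q)" by (metis oddE Suc_eq_plus1)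
      have e: "g [^]\<^bsub>H\<^esub> (2 * q) \<in> N" by (rule even_pow)
      have "g [^]\<^bsub>H\<^esub> (2 * q) \<otimes>\<^bsub>H\<^esub> g \<in> N" using k by (simp add: q)
      \<comment> \<open>If an odd power lay in \<open>N\<close>, cancelling the even power, which
        does, would put \<open>g\<close> into \<open>N\<close>.\<close>
      then have "inv\<^bsub>H\<^esub> (g [^]\<^bsub>H\<^esub> (2 * q)) \<otimes>\<^bsub>H\<^esub> (g [^]\<^bsub>H\<^esub> (2 * q) \<otimes>\<^bsub>H\<^esub> g) \<in> N" using e by simp
      then show False using gN by (simp add: m_assoc[symmetric])
    qed
    show "\<exists>s\<in>carrier (H\<lparr>carrier := N\<rparr>). \<exists>k::nat. x = s \<otimes>\<^bsub>H\<^esub> g [^]\<^bsub>H\<^esub> k" if x: "x \<in> carrier H" for x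
    proof (cases "x \<in> N")
      case True
      then show ?thesis using x by (intro bexI[of _ x] exI[of _ 0]) auto
    next
      case False
      then have "x \<otimes>\<^bsub>H\<^esub> inv\<^bsub>H\<^esub> g \<in> N" using quotient x g by simp
      then show ?thesis using x by (intro bexI[of _ "x \<otimes>\<^bsub>H\<^esub> inv\<^bsub>H\<^esub> g"] exI[of _ 1]) (auto simp: m_assoc)
    qed
  qed (use H \<alpha> conj gg in auto)
qed

text \<open>Equality of outer classes says that conjugation by \<open>h\<close> is \<alpha> followed
  by conjugation by some \<open>x\<close> in \<open>N\<close>. Then \<open>g\<close> = x\<inverse>h
  induces \<alpha> itself and still lies outside \<open>N\<close>.\<close>

lemma exists_conjugating_element:
  assumes H: "group H" and normal: "N \<lhd> H" and h: "h \<in> carrier H - N"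
    and \<alpha>: "\<alpha> \<in> auto (H\<lparr>carrier := N\<rparr>)"
    and cls: "out_class (H\<lparr>carrier := N\<rparr>) (conj_by H N h) = out_class (H\<lparr>carrier := N\<rparr>) \<alpha>"
  obtains g where "g \<in> carrier H - N" "\<And>s. s \<in> N \<Longrightarrow> g \<otimes>\<^bsub>H\<^esub> s = \<alpha> s \<otimes>\<^bsub>H\<^esub> g"
proof -
  interpret normal N H by fact
  have sub: "subgroup N H" by (rule subgroup_axioms)
  let ?N = "H\<lparr>carrier := N\<rparr>"
  have hc: "h \<in> carrier H" and hN: "h \<notin> N" using h by auto
  have conj_N: "conj_by ?N N x = conj_by H N x" if "x \<in> N" for x
    using that m_inv_consistent[OF sub] by (simp add: conj_by_def)
  have mult: "\<phi> \<otimes>\<^bsub>AutoGroup ?N\<^esub> \<psi> = compose N \<phi> \<psi>" if "\<phi> \<in> Bij N" "\<psi> \<in> Bij N" for \<phi> \<psi>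
    using that by (simp add: AutoGroup_def BijGroup_def)
  have one: "conj_by ?N N \<one>\<^bsub>H\<^esub> = (\<lambda>x\<in>N. x)"
    unfolding conj_N[OF subgroup.one_closed[OF sub]] by (auto simp: conj_by_def intro!: restrict_ext)
  \<comment> \<open>Conjugation by \<open>h\<close> belongs to its own class, with the trivial inner
    automorphism as factor; the class equality then places it in the class of \<alpha>.\<close>
  have "conj_by ?N N \<one>\<^bsub>H\<^esub> \<otimes>\<^bsub>AutoGroup ?N\<^esub> conj_by H N h \<in> out_class ?N (conj_by H N h)"
    unfolding out_class_def r_coset_def inner_auts_def by force
  moreover have "conj_by ?N N \<one>\<^bsub>H\<^esub> \<otimes>\<^bsub>AutoGroup ?N\<^esub> conj_by H N h = conj_by H N h"
    unfolding one using conj_by_Bij[OF normal hc] by (simp add: mult id_Bij Bij_imp_funcset Bij_imp_extensional)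
  ultimately have "conj_by H N h \<in> out_class ?N \<alpha>" using cls by simp
  then obtain x where x: "x \<in> N" "conj_by H N h = conj_by ?N N x \<otimes>\<^bsub>AutoGroup ?N\<^esub> \<alpha>"
    unfolding out_class_def r_coset_def inner_auts_def by auto
  have xc [simp]: "x \<in> carrier H" using x by simp
  have \<alpha>_closed: "\<alpha> s \<in> N" if "s \<in> N" for s using \<alpha> that by (auto simp: auto_def hom_def)
  have "conj_by H N h = compose N (conj_by H N x) \<alpha>"
    using x \<alpha> conj_by_Bij[OF normal xc] by (simp add: conj_N mult auto_def)
  then have eq: "h \<otimes>\<^bsub>H\<^esub> s \<otimes>\<^bsub>H\<^esub> inv\<^bsub>H\<^esub> h = x \<otimes>\<^bsub>H\<^esub> \<alpha> s \<otimes>\<^bsub>H\<^esub> inv\<^bsub>H\<^esub> x" if "s \<in> N" for s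
    using that \<alpha>_closed[OF that] by (auto simp: conj_by_def compose_def dest: fun_cong[of _ _ s])
  let ?g = "inv\<^bsub>H\<^esub> x \<otimes>\<^bsub>H\<^esub> h"
  have "?g \<notin> N"
  proof
    assume "?g \<in> N"
    then have "x \<otimes>\<^bsub>H\<^esub> ?g \<in> N" using x by simp
    then show False using hN hc by (simp add: m_assoc[symmetric])
  qed
  moreover have "?g \<otimes>\<^bsub>H\<^esub> s = \<alpha> s \<otimes>\<^bsub>H\<^esub> ?g" if s: "s \<in> N" for s
  proof -
    have sc [simp]: "s \<in> carrier H" "\<alpha> s \<in> carrier H" using s \<alpha>_closed[OF s] by auto
    have "h \<otimes>\<^bsub>H\<^esub> s = h \<otimes>\<^bsub>H\<^esub> s \<otimes>\<^bsub>H\<^esub> inv\<^bsub>H\<^esub> h \<otimes>\<^bsub>H\<^esub> h" using hc by (simp add: m_assoc)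
    also have "\<dots> = x \<otimes>\<^bsub>H\<^esub> (\<alpha> s \<otimes>\<^bsub>H\<^esub> ?g)" unfolding eq[OF s] using hc by (simp add: m_assoc)
    finally have "inv\<^bsub>H\<^esub> x \<otimes>\<^bsub>H\<^esub> (h \<otimes>\<^bsub>H\<^esub> s) = inv\<^bsub>H\<^esub> x \<otimes>\<^bsub>H\<^esub> (x \<otimes>\<^bsub>H\<^esub> (\<alpha> s \<otimes>\<^bsub>H\<^esub> ?g))" by simp
    also have "\<dots> = \<alpha> s \<otimes>\<^bsub>H\<^esub> ?g" using hc by (simp add: m_assoc[symmetric])
    finally show ?thesis using hc by (simp add: m_assoc)
  qed
  ultimately show ?thesis using hc by (intro that[of ?g]) auto
qed

lemma index_two_proper:
  assumes "group H" "finite (carrier H)" "subgroup N H" "card (rcosets\<^bsub>H\<^esub> N) = 2"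
  obtains h where "h \<in> carrier H - N"
proof -
  interpret group H by fact
  have "2 * card N = card (carrier H)" using lagrange[OF assms(3)] assms(4) by (simp add: Coset.order_def)
  moreover have "card (carrier H) > 0" using assms(2) by (auto simp: card_gt_0_iff)
  ultimately have "carrier H \<noteq> N" by auto
  then show ?thesis using subgroup.subset[OF assms(3)] that by blast
qed

section \<open>Comparison of the index two overgroup with the semidirect product\<close>

theorem theorem4p3:
  fixes S :: "'s monoid" and Shat H :: "'a monoid" and p :: nat and P :: "'a set"
    and \<alpha> :: "'a \<Rightarrow> 'a"
  assumes "sporadic S"
    and "universal_cover Shat S"
    and "Factorial_Ring.prime p"
    and "P \<in> syl p Shat"
    and "Coset.order (Gamma_group Shat P) = 2"
    and "\<alpha> \<in> auts_stab Shat P"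
    and "Gamma_class Shat P \<alpha> \<noteq> \<one>\<^bsub>Gamma_group Shat P\<^esub>"
    and "group H" and "finite (carrier H)"
    and "H\<lparr>carrier := carrier Shat\<rparr> = Shat"
    and "carrier Shat \<lhd> H"
    and "card (rcosets\<^bsub>H\<^esub> (carrier Shat)) = 2"
    and "\<forall>h \<in> carrier H - carrier Shat.
           out_class Shat (conj_by H (carrier Shat) h) = out_class Shat \<alpha>"
  shows "\<forall>\<theta> \<in> Irr Shat.
     ((type_1 Shat \<alpha> \<theta> \<longleftrightarrow> (\<exists>\<psi> \<in> Irr H. res Shat \<psi> = \<theta>)) \<and>
      ((\<exists>\<psi> \<in> Irr H. res Shat \<psi> = \<theta>) \<longleftrightarrow>
       (\<exists>\<psi>' \<in> Irr (semidirect_cyclic Shat \<alpha>). res_semidirect Shat \<psi>' = \<theta>))) \<and>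
     ((type_2 Shat \<alpha> \<theta> \<longleftrightarrow>
       (\<exists>\<psi> \<in> Irr H. res Shat \<psi> = char_add Shat \<theta> (twist Shat \<theta> \<alpha>))) \<and>
      ((\<exists>\<psi> \<in> Irr H. res Shat \<psi> = char_add Shat \<theta> (twist Shat \<theta> \<alpha>)) \<longleftrightarrow>
       (\<exists>\<psi>' \<in> Irr (semidirect_cyclic Shat \<alpha>).
          res_semidirect Shat \<psi>' = char_add Shat \<theta> (twist Shat \<theta> \<alpha>))))"
proof -
  note H = assms(8,9) and Shat = assms(10) and normal = assms(11) and card = assms(12)
  interpret H: group H by fact
  have sub: "subgroup (carrier Shat) H" using normal by (rule normal_imp_subgroup)
  have \<alpha>: "\<alpha> \<in> auto Shat" using assms(6) by (simp add: auts_stab_def)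
  obtain h where h: "h \<in> carrier H - carrier Shat" using index_two_proper[OF H sub card] .
  obtain g where g: "g \<in> carrier H - carrier Shat"
    and conj: "\<And>s. s \<in> carrier Shat \<Longrightarrow> g \<otimes>\<^bsub>H\<^esub> s = \<alpha> s \<otimes>\<^bsub>H\<^esub> g"
    by (rule exists_conjugating_element[OF H(1) normal h, unfolded Shat, OF \<alpha>])
      (use assms(13) h in auto)
  interpret ext_H: cyclic_extension Shat H "\<lambda>s. s" g \<alpha> 2 "g \<otimes>\<^bsub>H\<^esub> g"
    using index_two_cyclic_extension[OF H normal card g, unfolded Shat, OF \<alpha> conj] .
  interpret ext_A: cyclic_extension Shat "semidirect_cyclic Shat \<alpha>" "\<lambda>s. (s, \<one>\<^bsub>AutoGroup Shat\<^esub>)"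
    "(\<one>\<^bsub>Shat\<^esub>, \<alpha>)" \<alpha> "group.ord (AutoGroup Shat) \<alpha>" "\<one>\<^bsub>Shat\<^esub>"
    using semidirect_cyclic_extension[OF ext_H.group_N ext_H.finite_N \<alpha>] .
  \<comment> \<open>The element \<open>t\<close> of \<open>N\<close> inducing \<alpha> \<circ>
    \<alpha> is the square of \<open>g\<close>, found inside \<open>H\<close>. The statement
    concerns only \<alpha> and \<open>N\<close>, so it serves the semidirect product as well, where
    the order of \<alpha> may exceed 2.\<close>
  have square: "\<alpha> (\<alpha> s) = (g \<otimes>\<^bsub>H\<^esub> g) \<otimes>\<^bsub>Shat\<^esub> s \<otimes>\<^bsub>Shat\<^esub> inv\<^bsub>Shat\<^esub> (g \<otimes>\<^bsub>H\<^esub> g)" if "s \<in> carrier Shat" for s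
    using ext_H.beta_pow_m[OF that] that ext_H.u_closed
    by (simp add: numeral_2_eq_2 ext_H.N.inv_solve_right)
  \<comment> \<open>Both groups satisfy the same criteria with the same \<alpha>, so each existence
    statement for one is equivalent to that for the other through the type of \<theta>.\<close>
  show ?thesis
    using ext_H.type_1_iff_extends ext_A.type_1_iff_extends
      ext_H.type_2_iff_extends[OF _ ext_H.u_closed square] ext_A.type_2_iff_extends[OF _ ext_H.u_closed square]
    unfolding res_def res_semidirect_def by simp
qed

end
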